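(* Let $\pi(x)$ denote the number of primes $\le x$ and $\pi_{RPR}(x)$ the number of RPR-primes $\le x$. Then $$\liminf_{x\to\infty}\frac{\pi_{RPR}(x)}{\pi(x)}\ \ge\ \frac12 .$$
   Context: A prime $p$ is an RPR-prime if, with $q$ the smallest prime greater than $p/2$, the open interval $(p,2q)$ contains a prime. (For odd $p=p_n$, $p_k$ the $k$-th prime, this is equivalent to all integers $\frac{p+1}{2},\frac{p+3}{2},\dots,\frac{p_{n+1}-1}{2}$ being composite.) *)

theory Defs
  imports "HOL-Analysis.Analysis" "HOL-Computational_Algebra.Primes"
begin

definition rpr_q :: "nat \<Rightarrow> nat" where
  "rpr_q p = (LEAST q. prime q \<and> real q > real p / 2)"

definition rpr_prime :: "nat \<Rightarrow> bool" where
  "rpr_prime p \<longleftrightarrow> prime p \<and> (\<exists>r. prime r \<and> p < r \<and> r < 2 * rpr_q p)"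

definition prime_pi :: "real \<Rightarrow> nat" where
  "prime_pi x = card {p::nat. prime p \<and> real p \<le> x}"

definition rpr_pi :: "real \<Rightarrow> nat" where
  "rpr_pi x = card {p::nat. rpr_prime p \<and> real p \<le> x}"

end

theory Submission
  imports Defs "HOL-Number_Theory.Prime_Powers" "HOL-Real_Asymp.Real_Asymp"
    "HOL-Complex_Analysis.Complex_Analysis" "HOL-Probability.Sinc_Integral"
begin

text \<open>
  If a prime \<open>p\<close> is not an RPR-prime, then \<open>2q\<close> lies between \<open>p\<close> and the next prime, where \<open>q\<close> is the
  smallest prime above \<open>p/2\<close>. Hence \<open>p \<mapsto> q\<close> is injective on the non-RPR-primes, and all but the
  largest non-RPR-prime up to \<open>x\<close> are sent to primes up to \<open>x/2\<close>. So at least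
  \<open>\<pi>(x) - \<pi>(x/2) - 1\<close> primes up to \<open>x\<close> are RPR-primes, and the prime number theorem gives
  \<open>\<pi>(x/2)/\<pi>(x) \<rightarrow> 1/2\<close>.

  The prime number theorem is obtained without contour integration. The function
  \<open>Z(s) = (s - 1)\<zeta>(s)\<close> extends to \<open>Re s > 0\<close> and has no zeros on \<open>Re s \<ge> 1\<close> by the 3-4-1 inequality.
  For \<open>h(t) = \<psi>(e\<^sup>t)e\<^sup>-\<^sup>t - 1\<close>, which is bounded by Chebyshev's estimate, the Laplace transform
  equals \<open>G(z) = -(1 + Z'(1+z)/Z(1+z))/(1+z)\<close> and is therefore holomorphic on \<open>Re z \<ge> 0\<close>.
  Convolving \<open>h\<close> with a Fejer kernel gives the integral of \<open>(1 - |u|/l) G(iu) e\<^sup>i\<^sup>u\<^sup>y\<close> over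
  \<open>[-l, l]\<close>, which tends to \<open>0\<close> as \<open>y \<rightarrow> \<infinity>\<close> by the Riemann-Lebesgue lemma. As \<open>(1 + h(t))e\<^sup>t\<close> is
  increasing, a large value of \<open>|h|\<close> would persist on an interval and keep these averages away from \<open>0\<close>;
  so \<open>h \<rightarrow> 0\<close>.
\<close>

section \<open>Counting non-RPR-primes\<close>

text \<open>One predicate conjoined with the bound is the shape in which the finite sets of numbers
  up to \<open>x\<close> occur below; this is why \<open>N\<close>, \<open>S\<close> and
  \<open>B\<close> bracket their other conditions together.\<close>

lemma finite_nats_le_real [simp]: "finite {n::nat. P n \<and> real n \<le> x}"
  by (rule finite_subset[of _ "{..nat \<lfloor>x\<rfloor>}"]) (auto simp: le_nat_floor)

lemma rpr_q_prime: "prime (rpr_q p)" and rpr_q_gt: "p < 2 * rpr_q p"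
proof -
  obtain q where "prime q" "p < q" using bigger_prime by blast
  then have "\<exists>q. prime q \<and> real q > real p / 2" by (intro exI[of _ q]) auto
  from LeastI_ex[OF this, folded rpr_q_def] show "prime (rpr_q p)" "p < 2 * rpr_q p" by auto
qed

text \<open>The summand 1 pays for the largest non-RPR-prime \<open>m\<close>, for which
  \<open>2 * rpr_q m\<close> may exceed \<open>x\<close>. For every other \<open>p\<close> in
  \<open>N\<close>, \<open>2 * rpr_q p\<close> is at most \<open>m\<close> and hence at most
  \<open>x\<close>.\<close>

lemma prime_pi_le_rpr_pi: "prime_pi x \<le> rpr_pi x + prime_pi (x / 2) + 1"
proof -
  define N where "N = {p. (prime p \<and> \<not> rpr_prime p) \<and> real p \<le> x}"
  have fin: "finite N" by (simp add: N_def)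
  have gap: "2 * rpr_q p \<le> r" if "p \<in> N" "prime r" "p < r" for p r
  proof (rule ccontr)
    assume "\<not> 2 * rpr_q p \<le> r"
    with that have "rpr_prime p" unfolding rpr_prime_def N_def by auto
    with that show False by (simp add: N_def)
  qed
  have inj: "inj_on rpr_q N"
  proof (rule linorder_inj_onI)
    fix p p' assume "p < p'" "p \<in> N" "p' \<in> N"
    \<comment> \<open>Here \<open>2 * rpr_q p <= p' < 2 * rpr_q p'\<close>, so the map is even
      strictly increasing on \<open>N\<close>.\<close>
    then show "rpr_q p \<noteq> rpr_q p'"
      using gap[of p p'] rpr_q_gt[of p'] by (auto simp: N_def)
  qed auto
  have "card N \<le> prime_pi (x / 2) + 1"
  proof (cases "N = {}")
    case False
    define m where "m = Max N"
    have m: "m \<in> N" using fin False by (simp add: m_def)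
    have "rpr_q ` (N - {m}) \<subseteq> {q. prime q \<and> real q \<le> x / 2}"
    proof
      fix q assume "q \<in> rpr_q ` (N - {m})"
      then obtain p where p: "p \<in> N" "p \<noteq> m" "q = rpr_q p" by auto
      then have "p < m" using fin by (simp add: m_def le_neq_implies_less)
      with gap[of p m] p m have "2 * q \<le> m" by (auto simp: N_def)
      then have "2 * real q \<le> real m" by linarith
      with m p show "q \<in> {q. prime q \<and> real q \<le> x / 2}"
        by (auto simp: N_def rpr_q_prime)
    qed
    then have "card (rpr_q ` (N - {m})) \<le> prime_pi (x / 2)"
      unfolding prime_pi_def by (intro card_mono finite_nats_le_real)
    moreover have "card (rpr_q ` (N - {m})) = card N - 1"
      using inj m by (subst card_image) (auto simp: inj_on_diff fin)
    ultimately show ?thesis by simp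
  qed simp
  moreover have "{p::nat. prime p \<and> real p \<le> x} = {p. rpr_prime p \<and> real p \<le> x} \<union> N"
    by (auto simp: N_def rpr_prime_def)
  then have "prime_pi x \<le> rpr_pi x + card N"
    unfolding prime_pi_def rpr_pi_def by (simp add: card_Un_le)
  ultimately show ?thesis by simp
qed

section \<open>Chebyshev's function\<close>

definition chebyshev_psi :: "real \<Rightarrow> real" where
  "chebyshev_psi x = (\<Sum>n | 0 < n \<and> real n \<le> x. mangoldt n)"

text \<open>Group the prime powers up to \<open>x\<close> by their prime \<open>p\<close>. At most
  \<open>ln x / ln p\<close> exponents occur, each with weight \<open>ln p\<close>, so every prime
  contributes at most \<open>ln x\<close>.\<close>

lemma chebyshev_psi_le_prime_pi:
  assumes "x \<ge> 1"
  shows "chebyshev_psi x \<le> real (prime_pi x) * ln x"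
proof -
  define S where "S = {n. (0 < n \<and> primepow n) \<and> real n \<le> x}"
  define T where "T = {p::nat. prime p \<and> real p \<le> x}"
  have fin: "finite S" "finite T" by (simp_all add: S_def T_def)
  have "chebyshev_psi x = (\<Sum>n\<in>S. ln (real (aprimedivisor n)))"
    unfolding chebyshev_psi_def
    by (intro sum.mono_neutral_cong_right) (auto simp: S_def mangoldt_def)
  also have "\<dots> = (\<Sum>p\<in>T. \<Sum>n | n \<in> S \<and> aprimedivisor n = p. ln (real (aprimedivisor n)))"
  proof (rule sum.group[symmetric, OF fin], safe)
    fix n assume "n \<in> S"
    then have "primepow n" "n > 0" "real n \<le> x" by (auto simp: S_def)
    moreover from this have "aprimedivisor n dvd n" "prime (aprimedivisor n)"
      using primepow_gt_Suc_0[of n] aprimedivisor_dvd'[of n] prime_aprimedivisor'[of n] by auto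
    ultimately show "aprimedivisor n \<in> T"
      using dvd_imp_le[of "aprimedivisor n" n] by (auto simp: T_def)
  qed
  also have "\<dots> \<le> (\<Sum>p\<in>T. ln x)"
  proof (rule sum_mono)
    fix p assume "p \<in> T"
    then have p: "prime p" "real p \<le> x" by (auto simp: T_def)
    then have p1: "real p > 1" using prime_gt_1_nat by simp
    then have lnp: "ln (real p) > 0" by simp
    define A where "A = {n. n \<in> S \<and> aprimedivisor n = p}"
    have "A \<subseteq> (\<lambda>k. p ^ k) ` {1..nat \<lfloor>ln x / ln (real p)\<rfloor>}"
    proof
      fix n assume n: "n \<in> A"
      then obtain q k where qk: "prime q" "k > 0" "n = q ^ k"
        by (auto simp: A_def S_def primepow_def)
      with n have "q = p" by (auto simp: A_def aprimedivisor_prime_power)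
      with qk n have "real p ^ k \<le> x" by (auto simp: A_def S_def)
      then have "ln (real p ^ k) \<le> ln x" using p1 assms by (subst ln_le_cancel_iff) auto
      then have "real k \<le> ln x / ln (real p)" using lnp p1 by (simp add: ln_realpow field_simps)
      then have "k \<le> nat \<lfloor>ln x / ln (real p)\<rfloor>" by (simp add: le_nat_floor)
      with qk \<open>q = p\<close> show "n \<in> (\<lambda>k. p ^ k) ` {1..nat \<lfloor>ln x / ln (real p)\<rfloor>}" by auto
    qed
    from card_mono[OF _ this] have "card A \<le> nat \<lfloor>ln x / ln (real p)\<rfloor>"
      using card_image_le[of "{1..nat \<lfloor>ln x / ln (real p)\<rfloor>}" "\<lambda>k. p ^ k"]
      by simp
    moreover have "ln x / ln (real p) \<ge> 0" using assms lnp by simp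
    ultimately have "real (card A) \<le> ln x / ln (real p)" by linarith
    then have "real (card A) * ln (real p) \<le> ln x" using lnp by (simp add: field_simps)
    moreover have "(\<Sum>n\<in>A. ln (real (aprimedivisor n))) = real (card A) * ln (real p)"
      by (simp add: A_def)
    ultimately show "(\<Sum>n | n \<in> S \<and> aprimedivisor n = p. ln (real (aprimedivisor n))) \<le> ln x"
      by (simp add: A_def)
  qed
  finally show ?thesis by (simp add: prime_pi_def T_def)
qed

text \<open>Primes up to the cut \<open>y\<close> are counted trivially; each prime in
  \<open>(y, x]\<close> contributes at least \<open>ln y\<close> to \<open>chebyshev_psi x\<close>.
  The cut stays free and is chosen in \<open>prime_number_theorem\<close>.\<close>

lemma prime_pi_le_chebyshev_psi:
  assumes "1 < y" "y \<le> x"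
  shows "real (prime_pi x) \<le> y + chebyshev_psi x / ln y"
proof -
  define A where "A = {p::nat. prime p \<and> real p \<le> y}"
  define B where "B = {p::nat. (prime p \<and> y < real p) \<and> real p \<le> x}"
  have fin: "finite A" "finite B" by (simp_all add: A_def B_def)
  have "A \<subseteq> {1..nat \<lfloor>y\<rfloor>}"
    by (auto simp: A_def le_nat_floor Suc_le_eq prime_gt_0_nat)
  from card_mono[OF _ this] have A: "real (card A) \<le> y" using assms(1) by simp linarith
  have "real (card B) * ln y = (\<Sum>p\<in>B. ln y)" by simp
  also have "\<dots> \<le> (\<Sum>p\<in>B. mangoldt p)"
    using assms by (intro sum_mono) (auto simp: B_def)
  also have "\<dots> \<le> chebyshev_psi x"
    unfolding chebyshev_psi_def
    by (intro sum_mono2) (auto simp: B_def mangoldt_nonneg prime_gt_0_nat)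
  finally have B: "real (card B) \<le> chebyshev_psi x / ln y" using assms by (simp add: field_simps)
  have "{p::nat. prime p \<and> real p \<le> x} = A \<union> B" using assms by (auto simp: A_def B_def)
  then have "prime_pi x \<le> card A + card B" by (simp add: prime_pi_def card_Un_le)
  with A B show ?thesis by linarith
qed

section \<open>Chebyshev's upper bound for the psi function\<close>

lemma card_multiples_atLeastAtMost:
  assumes "d > 0"
  shows "card {n\<in>{1..N}. d dvd n} = N div d"
proof -
  have "{n\<in>{1..N}. d dvd n} = (\<lambda>k. d * k) ` {1..N div d}"
  proof (intro equalityI subsetI)
    fix n assume "n \<in> {n\<in>{1..N}. d dvd n}"
    then obtain k where k: "n = d * k" "1 \<le> n" "n \<le> N" by auto
    then have "k \<le> N div d" using assms by (simp add: less_eq_div_iff_mult_less_eq mult.commute)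
    with k show "n \<in> (\<lambda>k. d * k) ` {1..N div d}"
      by (intro image_eqI[of _ _ k]) (auto simp: Suc_le_eq intro!: Nat.gr0I)
  next
    fix n assume "n \<in> (\<lambda>k. d * k) ` {1..N div d}"
    then obtain k where "n = d * k" "k \<in> {1..N div d}" by (rule imageE)
    then show "n \<in> {n\<in>{1..N}. d dvd n}"
      using assms by (auto simp: less_eq_div_iff_mult_less_eq mult.commute Suc_le_eq)
  qed
  moreover have "inj_on (\<lambda>k. d * k) {1..N div d}" using assms by (auto simp: inj_on_def)
  ultimately show ?thesis by (simp add: card_image)
qed

text \<open>Expand each \<open>ln n\<close> as the sum of \<open>mangoldt d\<close> over the
  divisors of \<open>n\<close> and exchange the sums. Terms with \<open>d > N\<close> vanish; the
  larger range \<open>M\<close> lets the formulas for \<open>n\<close> and \<open>2 * n\<close> be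
  subtracted term by term.\<close>

lemma ln_fact_eq_sum_mangoldt:
  assumes "N \<le> M"
  shows "ln (fact N) = (\<Sum>d=1..M. mangoldt d * real (N div d))"
proof -
  have "ln (fact N :: real) = (\<Sum>n=1..N. ln (real n))"
    unfolding fact_prod of_nat_prod by (rule ln_prod) auto
  also have "\<dots> = (\<Sum>n=1..N. \<Sum>d | d dvd n. mangoldt d)"
    by (intro sum.cong refl, subst mangoldt_sum) auto
  also have "\<dots> = (\<Sum>n=1..N. \<Sum>d=1..M. if d dvd n then mangoldt d else 0)"
  proof (rule sum.cong[OF refl])
    fix n assume n: "n \<in> {1..N}"
    have "d \<in> {1..M}" if "d dvd n" for d
      using that n assms dvd_imp_le[of d n] by (auto simp: Suc_le_eq intro!: Nat.gr0I)
    then have "{d. d dvd n} = {d\<in>{1..M}. d dvd n}" by auto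
    then show "(\<Sum>d | d dvd n. mangoldt d :: real) = (\<Sum>d=1..M. if d dvd n then mangoldt d else 0)"
      by (simp only: sum.inter_filter finite_atLeastAtMost)
  qed
  also have "\<dots> = (\<Sum>d=1..M. \<Sum>n=1..N. if d dvd n then mangoldt d else 0)"
    by (rule sum.swap)
  also have "\<dots> = (\<Sum>d=1..M. mangoldt d * real (N div d))"
  proof (rule sum.cong[OF refl])
    fix d assume "d \<in> {1..M}"
    then have "card {n\<in>{1..N}. d dvd n} = N div d" by (intro card_multiples_atLeastAtMost) auto
    then show "(\<Sum>n=1..N. if d dvd n then mangoldt d else 0 :: real) = mangoldt d * real (N div d)"
      by (subst sum.inter_filter[symmetric]) (simp_all add: mult.commute)
  qed
  finally show ?thesis .
qed

text \<open>The logarithm of the central binomial coefficient is the sum of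
  \<open>mangoldt d\<close> with coefficients \<open>2 * n div d - 2 * (n div d)\<close>. These are
  nonnegative, and equal to 1 for \<open>n < d <= 2 * n\<close>; the coefficient itself is at most
  \<open>2 ^ (2 * n)\<close>.\<close>

lemma sum_mangoldt_dyadic_le: "(\<Sum>d=n+1..2*n. mangoldt d) \<le> 2 * real n * ln 2"
proof -
  have "(\<Sum>d=n+1..2*n. mangoldt d)
      \<le> (\<Sum>d=n+1..2*n. mangoldt d * (real (2 * n div d) - 2 * real (n div d)))"
  proof (rule sum_mono)
    fix d assume d: "d \<in> {n+1..2*n}"
    then have "2 * n div d = 1" by (intro div_nat_eqI) auto
    with d show "mangoldt d \<le> mangoldt d * (real (2 * n div d) - 2 * real (n div d))" by simp
  qed
  also have "\<dots> \<le> (\<Sum>d=1..2*n. mangoldt d * (real (2 * n div d) - 2 * real (n div d)))"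
  proof (rule sum_mono2)
    fix d
    have "2 * (n div d) \<le> 2 * n div d"
      by (cases "d = 0") (auto simp: less_eq_div_iff_mult_less_eq)
    then have "2 * real (n div d) \<le> real (2 * n div d)" by linarith
    then show "0 \<le> mangoldt d * (real (2 * n div d) - 2 * real (n div d))"
      by (simp add: mangoldt_nonneg)
  qed auto
  also have "\<dots> = ln (fact (2 * n)) - 2 * ln (fact n)"
    unfolding ln_fact_eq_sum_mangoldt[of "2*n" "2*n", OF order.refl]
      ln_fact_eq_sum_mangoldt[of n "2*n", OF le_add2[of n n, folded mult_2]]
    by (simp add: right_diff_distrib sum_subtractf sum_distrib_left mult.left_commute)
  also have "\<dots> = ln (real ((2 * n) choose n))"
    by (simp add: binomial_fact ln_div ln_mult)
  also have "\<dots> \<le> ln (2 ^ (2 * n))"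
    using binomial_le_pow2[of "2*n" n]
    by (subst ln_le_cancel_iff) (auto simp: of_nat_le_iff[of _ "2 ^ _", where 'a = real, simplified])
  also have "\<dots> = 2 * real n * ln 2" by (simp add: ln_realpow)
  finally show ?thesis .
qed

text \<open>Strong induction by halving. With \<open>m = n div 2\<close> the hypothesis and the
  dyadic bound give \<open>4 * m + 2 * m\<close>, and the remaining slack \<open>2 * m\<close> below
  \<open>8 * m\<close> absorbs the last term when \<open>n\<close> is odd.\<close>

lemma sum_mangoldt_le: "(\<Sum>d=1..n. mangoldt d) \<le> 4 * real n"
proof (induction n rule: less_induct)
  case (less n)
  show ?case
  proof (cases "n = 0")
    case False
    define m where "m = n div 2"
    have "m < n" using False by (simp add: m_def)
    have "(\<Sum>d=1..2*m. mangoldt d) = (\<Sum>d=1..m. mangoldt d) + (\<Sum>d=m+1..2*m. mangoldt d :: real)"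
      using sum.ub_add_nat[of 1 m mangoldt m] by (simp add: mult_2)
    also have "\<dots> \<le> 4 * real m + 2 * real m * ln 2"
      using less.IH[OF \<open>m < n\<close>] sum_mangoldt_dyadic_le[of m] by linarith
    also have "\<dots> \<le> 4 * real m + 2 * real m * 1"
      using ln_le_minus_one[of 2] by (intro add_left_mono mult_left_mono) auto
    finally have *: "(\<Sum>d=1..2*m. mangoldt d) \<le> 6 * real m" by simp
    show ?thesis
    proof (cases "even n")
      case True
      then have "n = 2 * m" by (simp add: m_def)
      with * show ?thesis by simp
    next
      case odd: False
      then have n: "n = Suc (2 * m)" by (simp add: m_def)
      have "mangoldt n \<le> ln (real n)" using False by (intro mangoldt_le) auto
      also have "\<dots> \<le> 2 * real m" using ln_le_minus_one[of "real n"] n by simp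
      finally show ?thesis using * by (simp add: n)
    qed
  qed simp
qed

lemma chebyshev_psi_eq_sum: "chebyshev_psi x = (\<Sum>d=1..nat \<lfloor>x\<rfloor>. mangoldt d)"
  unfolding chebyshev_psi_def
proof (rule sum.cong)
  have "real n \<le> x \<longleftrightarrow> n \<le> nat \<lfloor>x\<rfloor>" if "0 < n" for n
    using that by linarith
  then show "{n. 0 < n \<and> real n \<le> x} = {1..nat \<lfloor>x\<rfloor>}" by auto
qed simp

lemma chebyshev_psi_nonneg: "0 \<le> chebyshev_psi x"
  unfolding chebyshev_psi_def by (intro sum_nonneg mangoldt_nonneg)

lemma chebyshev_psi_mono: "x \<le> y \<Longrightarrow> chebyshev_psi x \<le> chebyshev_psi y"
  unfolding chebyshev_psi_def by (intro sum_mono2) (auto simp: mangoldt_nonneg)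

lemma chebyshev_psi_le:
  assumes "x \<ge> 0"
  shows "chebyshev_psi x \<le> 4 * x"
  using sum_mangoldt_le[of "nat \<lfloor>x\<rfloor>"] assms unfolding chebyshev_psi_eq_sum by linarith

section \<open>The zeta function on the half-plane \<open>Re s \<ge> 1\<close>\<close>

text \<open>The term for \<open>n = 0\<close> contributes nothing, since \<open>0 powr z = 0\<close>.\<close>

definition zeta_series :: "complex \<Rightarrow> complex" where
  "zeta_series s = (\<Sum>n. of_nat n powr - s)"

text \<open>Termwise differentiation under a locally uniform majorant. The derivative is passed on
  as a series \<open>D\<close>, because that series is what the Dirichlet product with
  \<open>mangoldt\<close> is compared with.\<close>

lemma zeta_series_facts:
  obtains D where
    "\<And>s. Re s > 1 \<Longrightarrow> (\<lambda>n. of_nat n powr - s) sums zeta_series s"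
    "\<And>s. Re s > 1 \<Longrightarrow> (\<lambda>n. of_real (ln (real n)) * of_nat n powr - s) sums D s"
    "\<And>s. Re s > 1 \<Longrightarrow> (zeta_series has_field_derivative - D s) (at s)"
proof -
  let ?S = "{s. Re s > 1}"
  have op: "open ?S" by (rule open_halfspace_Re_gt)
  have "\<exists>g g'. \<forall>s\<in>?S. (\<lambda>n. of_nat n powr - s) sums g s \<and>
      (\<lambda>n. - (of_real (ln (real n)) * of_nat n powr - s)) sums g' s \<and>
      (g has_field_derivative g' s) (at s)"
  proof (rule series_and_derivative_comparison_complex[OF op])
    fix n :: nat and s :: complex
    assume "s \<in> ?S"
    show "((\<lambda>s. of_nat n powr - s) has_field_derivative - (of_real (ln (real n)) * of_nat n powr - s)) (at s)"
    proof (cases "n = 0")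
      case False
      then show ?thesis
        using DERIV_chain[OF has_field_derivative_powr_right[of "of_nat n" "-s"] DERIV_minus[OF DERIV_ident]]
        by (simp add: o_def)
    qed simp
  next
    fix s assume s: "s \<in> ?S"
    \<comment> \<open>The midpoint between 1 and \<open>Re s\<close>: on the ball of radius
      \<open>a - 1\<close> around \<open>s\<close> the real part stays at least \<open>a\<close>, so
      \<open>n powr - a\<close> is a summable majorant.\<close>
    define a where "a = (Re s + 1) / 2"
    have a: "a > 1" using s by (simp add: a_def)
    have le: "cmod (of_nat n powr - y) \<le> real n powr - a" if "y \<in> ball s (a - 1)" for n y
    proof (cases "n = 0")
      case False
      have "\<bar>Re (s - y)\<bar> < a - 1"
        using that abs_Re_le_cmod[of "s - y"] by (simp add: dist_norm del: minus_complex.simps)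
      then have "Re y \<ge> a" by (simp add: a_def abs_if field_simps split: if_splits)
      then show ?thesis using False by (simp add: norm_powr_real_powr powr_mono)
    qed simp
    show "\<exists>d h. 0 < d \<and> summable h \<and> range h \<subseteq> \<real>\<^sub>\<ge>\<^sub>0 \<and>
        (\<forall>\<^sub>F n in sequentially. \<forall>y\<in>ball s d \<inter> ?S. cmod (of_nat n powr - y) \<le> cmod (h n))"
      using a le
      by (intro exI[of _ "a - 1"] exI[of _ "\<lambda>n. of_real (real n powr - a)"])
         (auto simp: summable_of_real summable_real_powr_iff nonneg_Reals_of_real_iff intro!: always_eventually)
  qed
  then obtain g g' where g: "\<And>s. Re s > 1 \<Longrightarrow> (\<lambda>n. of_nat n powr - s) sums g s"
    "\<And>s. Re s > 1 \<Longrightarrow> (\<lambda>n. - (of_real (ln (real n)) * of_nat n powr - s)) sums g' s"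
    "\<And>s. Re s > 1 \<Longrightarrow> (g has_field_derivative g' s) (at s)" by auto
  have eq: "g s = zeta_series s" if "Re s > 1" for s
    using g(1)[OF that] by (simp add: zeta_series_def sums_iff)
  show thesis
  proof (rule that[of "\<lambda>s. - g' s"])
    fix s :: complex assume s: "Re s > 1"
    show "(\<lambda>n. of_nat n powr - s) sums zeta_series s" using g(1)[OF s] eq[OF s] by simp
    show "(\<lambda>n. of_real (ln (real n)) * of_nat n powr - s) sums - g' s"
      using sums_minus[OF g(2)[OF s]] by simp
    show "(zeta_series has_field_derivative - (- g' s)) (at s)"
      by (rule has_field_derivative_transform_within_open[of g _ _ ?S]) (use g(3)[OF s] eq s op in auto)
  qed
qed

section \<open>Continuation of (s - 1) zeta(s) to the right half-plane\<close>

text \<open>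
  Adding the telescoping differences of \<open>n powr (1 - s)\<close> to the series of \<open>(s - 1)\<zeta>(s)\<close> makes
  its terms \<open>O(n powr (- Re s - 1))\<close>, so that it converges for \<open>Re s > 0\<close>.
\<close>

definition zeta_term :: "nat \<Rightarrow> complex \<Rightarrow> complex" where
  "zeta_term n s = (s - 1) * of_nat (Suc n) powr - s
     + of_nat (Suc (Suc n)) powr (1 - s) - of_nat (Suc n) powr (1 - s)"

text \<open>Two mean value estimates on the segment from \<open>a = n + 1\<close> to
  \<open>a + 1\<close>. The term is the increment of \<open>?f\<close>, whose derivative is
  \<open>s - 1\<close> times a difference of values of \<open>z powr - s\<close>; that difference is
  bounded by the first estimate, \<open>cmod s * a powr (- Re s - 1)\<close>.\<close>

lemma norm_zeta_term_le:
  assumes s: "Re s > 0"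
  shows "cmod (zeta_term n s) \<le> cmod (s - 1) * cmod s * real (Suc n) powr (- Re s - 1)"
proof -
  define a where "a = real (Suc n)"
  have a: "a > 0" by (simp add: a_def)
  define S where "S = complex_of_real ` {a..a+1}"
  have S_eq: "S = closed_segment (of_real a) (of_real (a + 1))"
    unfolding S_def closed_segment_of_real by (simp add: closed_segment_eq_real_ivl)
  have cvx: "convex S" by (simp add: S_eq)
  have aS: "of_real a \<in> S" "of_real (a + 1) \<in> S" by (simp_all add: S_eq)
  define B where "B = cmod s * a powr (- Re s - 1)"
  have B: "B \<ge> 0" by (simp add: B_def)
  have dist: "cmod (z - of_real a) \<le> 1" if "z \<in> S" for z
  proof -
    from that obtain x where x: "z = of_real x" "a \<le> x" "x \<le> a + 1" by (auto simp: S_def)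
    have "z - of_real a = of_real (x - a)" by (simp add: x)
    then show ?thesis using x by (simp only: norm_of_real)
  qed
  have 1: "cmod (z powr - s - of_real a powr - s) \<le> B" if z: "z \<in> S" for z
  proof -
    have "cmod (z powr - s - of_real a powr - s) \<le> B * cmod (z - of_real a)"
    proof (rule field_differentiable_bound[OF cvx _ _ z aS(1)])
      fix w assume "w \<in> S"
      then obtain x where x: "w = of_real x" "a \<le> x" "x \<le> a + 1" by (auto simp: S_def)
      have "w \<notin> \<real>\<^sub>\<le>\<^sub>0" using x(2) a unfolding x(1) by (simp add: complex_nonpos_Reals_iff)
      then show "((\<lambda>z. z powr - s) has_field_derivative - s * w powr (- s - 1)) (at w within S)"
        by (rule has_field_derivative_at_within[OF has_field_derivative_powr])
      have "x powr (- Re s - 1) \<le> a powr (- Re s - 1)" using x a s by (intro powr_mono2') auto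
      then show "cmod (- s * w powr (- s - 1)) \<le> B"
        using x a by (auto simp: norm_mult norm_powr_real_powr B_def intro!: mult_left_mono)
    qed
    also have "\<dots> \<le> B * 1" using B dist[OF z] by (intro mult_left_mono)
    finally show ?thesis by simp
  qed
  let ?f = "\<lambda>z. (s - 1) * of_real a powr - s * z + z powr (1 - s)"
  have "cmod (?f (of_real (a + 1)) - ?f (of_real a)) \<le> (cmod (s - 1) * B) * cmod (of_real (a + 1) - of_real a :: complex)"
  proof (rule field_differentiable_bound[OF cvx _ _ aS(2) aS(1)])
    fix w assume w: "w \<in> S"
    then obtain x where x: "w = of_real x" "a \<le> x" "x \<le> a + 1" by (auto simp: S_def)
    have "w \<notin> \<real>\<^sub>\<le>\<^sub>0" using x(2) a unfolding x(1) by (simp add: complex_nonpos_Reals_iff)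
    from DERIV_add[OF DERIV_cmult[OF DERIV_ident] has_field_derivative_powr[OF this, of "1 - s"]]
    have "(?f has_field_derivative (s - 1) * of_real a powr - s + (1 - s) * w powr (- s)) (at w)"
      by simp
    then show "(?f has_field_derivative (s - 1) * of_real a powr - s + (1 - s) * w powr (- s)) (at w within S)"
      by (rule has_field_derivative_at_within)
    have "(s - 1) * of_real a powr - s + (1 - s) * w powr (- s)
        = - (s - 1) * (w powr - s - of_real a powr - s)" by (simp add: algebra_simps)
    then show "cmod ((s - 1) * of_real a powr - s + (1 - s) * w powr (- s)) \<le> cmod (s - 1) * B"
      using 1[OF w] by (simp only: norm_mult norm_minus_cancel) (intro mult_left_mono, auto)
  qed
  also have "of_real (a + 1) - of_real a = (1::complex)" by simp
  also have "?f (of_real (a + 1)) - ?f (of_real a) = zeta_term n s"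
    by (simp add: a_def zeta_term_def algebra_simps)
  finally show ?thesis by (simp add: B_def a_def mult.assoc)
qed

text \<open>The leading 1 cancels the value -1 of the telescoping differences when
  \<open>Re s > 1\<close>, which leaves exactly (s - 1) zeta(s) there.\<close>

definition zeta_reg :: "complex \<Rightarrow> complex" where
  "zeta_reg s = 1 + (\<Sum>n. zeta_term n s)"

text \<open>The residue of zeta at its pole. The value also serves as the witness that
  \<open>zeta_reg\<close> is not identically zero.\<close>

lemma zeta_reg_1 [simp]: "zeta_reg 1 = 1"
proof -
  have "zeta_term n 1 = 0" for n by (simp add: zeta_term_def del: of_nat_Suc)
  then show ?thesis by (simp add: zeta_reg_def)
qed

lemma holomorphic_zeta_reg: "zeta_reg holomorphic_on {s. Re s > 0}"
proof -
  let ?S = "{s. Re s > 0}"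
  have op: "open ?S" by (rule open_halfspace_Re_gt)
  obtain f' where f': "\<And>n s. (zeta_term n has_field_derivative f' n s) (at s)"
  proof
    fix n s
    have "zeta_term n holomorphic_on UNIV"
      unfolding zeta_term_def by (intro holomorphic_intros)
    then show "(zeta_term n has_field_derivative deriv (zeta_term n) s) (at s)"
      by (rule holomorphic_derivI) auto
  qed
  have "\<exists>g g'. \<forall>s\<in>?S. (\<lambda>n. zeta_term n s) sums g s \<and> (\<lambda>n. f' n s) sums g' s \<and>
      (g has_field_derivative g' s) (at s)"
  proof (rule series_and_derivative_comparison_complex[OF op f'])
    fix s assume s: "s \<in> ?S"
    \<comment> \<open>On the ball of radius \<open>a\<close> around \<open>s\<close> the real part
      stays above \<open>a\<close> and the modulus below \<open>M\<close>, so the bound on the terms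
      becomes one summable majorant.\<close>
    define a where "a = Re s / 2"
    define M where "M = cmod s + a"
    have a: "a > 0" using s by (simp add: a_def)
    then have M0: "M \<ge> 0" by (simp add: M_def)
    have le: "cmod (zeta_term n y) \<le> (M + 1) * M * real (Suc n) powr (- a - 1)" if "y \<in> ball s a" for n y
    proof -
      have d: "cmod (s - y) < a" using that by (simp add: dist_norm)
      then have "\<bar>Re (s - y)\<bar> < a"
        using abs_Re_le_cmod[of "s - y"] by linarith
      then have y: "Re y > a" by (simp add: a_def abs_if field_simps split: if_splits)
      have M: "cmod y \<le> M" using norm_triangle_ineq2[of y s] d by (simp add: M_def norm_minus_commute)
      have M1: "cmod (y - 1) \<le> M + 1" using norm_triangle_ineq4[of y 1] M by simp
      have "cmod (zeta_term n y) \<le> cmod (y - 1) * cmod y * real (Suc n) powr (- Re y - 1)"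
        using y a by (intro norm_zeta_term_le) simp
      also have "\<dots> \<le> (M + 1) * M * real (Suc n) powr (- a - 1)"
        using y a M M1 M0 by (intro mult_mono powr_mono) auto
      finally show ?thesis .
    qed
    have "summable (\<lambda>n. (M + 1) * M * real (Suc n) powr (- a - 1))"
      using a by (subst summable_Suc_iff[of "\<lambda>n. (M + 1) * M * real n powr (- a - 1)"])
        (auto intro!: summable_mult simp: summable_real_powr_iff)
    then show "\<exists>d h. 0 < d \<and> summable h \<and> range h \<subseteq> \<real>\<^sub>\<ge>\<^sub>0 \<and>
        (\<forall>\<^sub>F n in sequentially. \<forall>y\<in>ball s d \<inter> ?S. cmod (zeta_term n y) \<le> cmod (h n))"
      using a M0 le
      by (intro exI[of _ a] exI[of _ "\<lambda>n. complex_of_real ((M + 1) * M * real (Suc n) powr (- a - 1))"])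
         (auto simp only: summable_of_real nonneg_Reals_of_real_iff norm_of_real intro!: always_eventually, auto)
  qed
  then obtain g g' where g: "\<And>s. Re s > 0 \<Longrightarrow> (\<lambda>n. zeta_term n s) sums g s"
    "\<And>s. Re s > 0 \<Longrightarrow> (g has_field_derivative g' s) (at s)" by auto
  have "(\<lambda>s. 1 + g s) holomorphic_on ?S"
    using g(2) by (intro holomorphic_intros) (auto simp: holomorphic_on_open[OF op])
  moreover have "1 + g s = zeta_reg s" if "s \<in> ?S" for s
    using g(1)[of s] that by (simp add: zeta_reg_def sums_iff)
  ultimately show ?thesis by (rule holomorphic_transform)
qed

lemma zeta_reg_eq_zeta_series:
  assumes s: "Re s > 1"
  shows "zeta_reg s = (s - 1) * zeta_series s"
proof -
  have "(\<lambda>n. of_nat n powr - s) sums zeta_series s" using zeta_series_facts s by metis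
  then have "(\<lambda>n. of_nat (Suc n) powr - s) sums zeta_series s"
    by (subst sums_Suc_iff) simp
  then have 1: "(\<lambda>n. (s - 1) * of_nat (Suc n) powr - s) sums ((s - 1) * zeta_series s)"
    by (rule sums_mult)
  have "(\<lambda>n. of_nat (Suc n) powr (1 - s)) \<longlonglongrightarrow> (0 :: complex)"
  proof (rule tendsto_norm_zero_cancel)
    have "((\<lambda>x. x powr (1 - Re s)) \<longlongrightarrow> 0) at_top"
      using s by (intro tendsto_neg_powr filterlim_ident) auto
    from filterlim_compose[OF this filterlim_compose[OF filterlim_real_sequentially filterlim_Suc]]
    show "(\<lambda>n. cmod (of_nat (Suc n) powr (1 - s))) \<longlonglongrightarrow> 0"
      by (simp add: norm_powr_real_powr)
  qed
  from telescope_sums[OF this]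
  have 2: "(\<lambda>n. of_nat (Suc (Suc n)) powr (1 - s) - of_nat (Suc n) powr (1 - s)) sums (- 1 :: complex)"
    by simp
  have "(\<lambda>n. zeta_term n s) sums ((s - 1) * zeta_series s + - 1)"
    using sums_add[OF 1 2] by (simp add: zeta_term_def add_diff_eq)
  then show ?thesis by (simp add: zeta_reg_def sums_iff)
qed

section \<open>The Dirichlet series of the von Mangoldt function\<close>

definition mangoldt_series :: "complex \<Rightarrow> complex" where
  "mangoldt_series s = (\<Sum>n. mangoldt n * of_nat n powr - s)"

lemma norm_nat_powr: "cmod (of_nat n powr s) = real n powr Re s"
  by (simp add: norm_powr_real_powr)

text \<open>Convergence is read off from the differentiated zeta series at the real point
  \<open>a\<close>.\<close>

lemma summable_ln_powr:
  assumes "a > 1"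
  shows "summable (\<lambda>n. ln (real n) * real n powr - a)"
proof -
  obtain D where "(\<lambda>n. of_real (ln (real n)) * of_nat n powr - of_real a) sums (D :: complex)"
    using zeta_series_facts assms by (metis Re_complex_of_real)
  moreover have "of_real (ln (real n)) * of_nat n powr - of_real a = complex_of_real (ln (real n) * real n powr - a)" for n
    using powr_of_real[of "real n" "-a"] by simp
  ultimately have "summable (\<lambda>n. complex_of_real (ln (real n) * real n powr - a))"
    by (simp add: sums_iff)
  then show ?thesis by (simp only: summable_complex_of_real)
qed

lemma norm_mangoldt_powr_le:
  "norm (mangoldt n * of_nat n powr - s :: complex) \<le> ln (real n) * real n powr - Re s"
proof (cases "n = 0")
  case False
  then show ?thesis
    by (auto simp: norm_mult norm_nat_powr intro!: mult_right_mono mangoldt_le)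
qed simp

lemma summable_norm_mangoldt_series:
  assumes "Re s > 1"
  shows "summable (\<lambda>n. norm (mangoldt n * of_nat n powr - s :: complex))"
  by (rule summable_comparison_test[OF _ summable_ln_powr[OF assms]])
     (use norm_mangoldt_powr_le in auto)

text \<open>Passes from series to unconditional sums over the positive integers. Index 0 has to go
  before sums are regrouped by divisors, since every number divides 0.\<close>

lemma norm_summable_imp_has_sum_pos:
  fixes f :: "nat \<Rightarrow> complex"
  assumes "summable (\<lambda>n. norm (f n))" "f 0 = 0"
  shows "(f has_sum suminf f) {1..}" "(\<lambda>n. norm (f n)) summable_on {1..}"
proof -
  have "(f has_sum suminf f) UNIV"
    using assms summable_norm_cancel by (intro norm_summable_imp_has_sum) (auto simp: summable_sums)
  also have "?this \<longleftrightarrow> (f has_sum suminf f) {1..}"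
    using assms by (intro has_sum_cong_neutral) (auto simp: Suc_le_eq)
  finally show "(f has_sum suminf f) {1..}" .
  have "(\<lambda>n. norm (f n)) summable_on UNIV"
    using assms by (intro norm_summable_imp_summable_on) auto
  then show "(\<lambda>n. norm (f n)) summable_on {1..}" by (rule summable_on_subset_banach) auto
qed

text \<open>The Dirichlet convolution of \<open>mangoldt\<close> with the constant 1 is the
  logarithm. Absolute convergence permits regrouping the double sum over \<open>(d, m)\<close> by
  \<open>n = d * m\<close>. As \<open>- D\<close> is the derivative of zeta, the Mangoldt series
  acts as minus its logarithmic derivative.\<close>

lemma mangoldt_series_times_zeta_series:
  assumes s: "Re s > 1"
    and D: "(\<lambda>n. of_real (ln (real n)) * of_nat n powr - s) sums D"
  shows "mangoldt_series s * zeta_series s = D"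
proof -
  define a where "a = (\<lambda>d. mangoldt d * of_nat d powr - s :: complex)"
  define b where "b = (\<lambda>m. of_nat m powr - s :: complex)"
  define c where "c = (\<lambda>n. of_real (ln (real n)) * of_nat n powr - s :: complex)"
  let ?P = "{1..} :: nat set"
  have sa: "summable (\<lambda>n. norm (a n))"
    unfolding a_def by (rule summable_norm_mangoldt_series[OF s])
  have sb: "summable (\<lambda>n. norm (b n))"
    using s by (simp add: b_def norm_nat_powr summable_real_powr_iff)
  have sc: "summable (\<lambda>n. norm (c n))"
  proof -
    have "norm (c n) = ln (real n) * real n powr - Re s" for n
      by (cases "n = 0") (auto simp: c_def norm_mult norm_nat_powr)
    then show ?thesis using summable_ln_powr[OF s] by simp
  qed
  note A = norm_summable_imp_has_sum_pos[OF sa] and B = norm_summable_imp_has_sum_pos[OF sb]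
    and C = norm_summable_imp_has_sum_pos[OF sc]
  have zero: "a 0 = 0" "b 0 = 0" "c 0 = 0" by (simp_all add: a_def b_def c_def)
  have "(\<lambda>x. norm ((\<lambda>(d, m). a d * b m) x)) summable_on ?P \<times> ?P"
    unfolding Infinite_Sum.abs_summable_on_Sigma_iff
    using A(2) B(2) zero
    by (auto simp: norm_mult infsum_cmult_right' abs_mult infsum_nonneg
             intro!: summable_on_cmult_right summable_on_cmult_left)
  then have sum: "(\<lambda>(d, m). a d * b m) summable_on ?P \<times> ?P" by (rule abs_summable_summable)
  let ?Q = "Sigma ?P (\<lambda>n. {d. d dvd n})"
  let ?F = "\<lambda>(n, d). mangoldt d * of_nat n powr - s :: complex"
  let ?h = "\<lambda>(d, m). (d * m, d :: nat)"
  have bij: "bij_betw ?h (?P \<times> ?P) ?Q"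
    by (rule bij_betwI[of _ _ _ "\<lambda>(n, d). (d, n div d)"])
       (auto simp: Suc_le_eq elim!: dvdE)
  have F: "?F (?h x) = (\<lambda>(d, m). a d * b m) x" if "x \<in> ?P \<times> ?P" for x
    using powr_times_real[of "of_nat (fst x)" "of_nat (snd x)" "-s"]
    by (simp add: a_def b_def case_prod_beta)
  have "suminf a * suminf b = infsum a ?P * infsum b ?P"
    using infsumI[OF A(1)] infsumI[OF B(1)] zero by simp
  also have "\<dots> = infsum (\<lambda>d. infsum (\<lambda>m. a d * b m) ?P) ?P"
    by (simp add: infsum_cmult_right' infsum_cmult_left')
  also have "\<dots> = infsum (\<lambda>(d, m). a d * b m) (?P \<times> ?P)"
    by (rule infsum_Sigma'_banach[OF sum])
  also have "\<dots> = infsum (\<lambda>x. ?F (?h x)) (?P \<times> ?P)"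
    by (intro infsum_cong) (simp only: F)
  also have "\<dots> = infsum ?F ?Q"
    by (rule infsum_reindex_bij_betw[OF bij])
  also have "\<dots> = infsum (\<lambda>n. infsum (\<lambda>d. mangoldt d * of_nat n powr - s) {d. d dvd n}) ?P"
  proof (rule infsum_Sigma'_banach[symmetric])
    have "(\<lambda>x. ?F (?h x)) summable_on ?P \<times> ?P"
      using sum by (subst summable_on_cong[OF F])
    then show "?F summable_on ?Q"
      by (subst (asm) summable_on_reindex_bij_betw[OF bij])
  qed
  also have "\<dots> = infsum c ?P"
  proof (rule infsum_cong)
    fix n assume "n \<in> ?P"
    then have n: "n > 0" by simp
    then have "infsum (\<lambda>d. mangoldt d * of_nat n powr - s) {d. d dvd n}
        = (\<Sum>d | d dvd n. mangoldt d) * of_nat n powr - s"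
      by (simp add: sum_distrib_right)
    also have "\<dots> = c n" using n by (subst mangoldt_sum) (auto simp: c_def)
    finally show "infsum (\<lambda>d. mangoldt d * of_nat n powr - s) {d. d dvd n} = c n" .
  qed
  also have "\<dots> = suminf c" using infsumI[OF C(1)] zero by simp
  also have "\<dots> = D" using D by (simp add: c_def sums_iff)
  finally show ?thesis by (simp add: a_def b_def mangoldt_series_def zeta_series_def)
qed

text \<open>The logarithmic derivative of (s - 1) zeta(s), multiplied out because the nonvanishing
  of \<open>zeta_reg\<close> has not been shown at this point.\<close>

lemma deriv_zeta_reg:
  assumes s: "Re s > 1"
  shows "deriv zeta_reg s = zeta_reg s * (1 / (s - 1) - mangoldt_series s)"
proof -
  obtain D where D: "(\<lambda>n. of_real (ln (real n)) * of_nat n powr - s) sums D"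
    "(zeta_series has_field_derivative - D) (at s)"
    using zeta_series_facts s by metis
  have "((\<lambda>s. (s - 1) * zeta_series s) has_field_derivative (zeta_series s + (s - 1) * - D)) (at s)"
    by (rule derivative_eq_intros D(2) refl | simp)+
  then have "(zeta_reg has_field_derivative (zeta_series s + (s - 1) * - D)) (at s)"
    by (rule has_field_derivative_transform_within_open[OF _ open_halfspace_Re_gt[of 1]])
       (use s in \<open>auto simp: zeta_reg_eq_zeta_series\<close>)
  then have "deriv zeta_reg s = zeta_series s + (s - 1) * - D" by (rule DERIV_imp_deriv)
  moreover have "s \<noteq> 1" using s by auto
  ultimately show ?thesis
    unfolding mangoldt_series_times_zeta_series[OF s D(1), symmetric] zeta_reg_eq_zeta_series[OF s]
    by (simp add: right_diff_distrib)
qed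

section \<open>Orders of vanishing and the 3-4-1 inequality\<close>

text \<open>Here \<open>m\<close> is the order of vanishing of \<open>f\<close> at \<open>z\<close>,
  seen as the residue of \<open>f' / f\<close> along the horizontal ray to the right. Connectedness
  and one point with \<open>f w \<noteq> 0\<close> make the order finite; at a zero, write
  \<open>f\<close> as \<open>(w - z) ^ n * g w\<close> with \<open>g\<close> nonvanishing near
  \<open>z\<close>.\<close>

lemma log_deriv_limit:
  assumes f: "f holomorphic_on S" and S: "open S" "connected S" "z \<in> S"
    and nz: "w \<in> S" "f w \<noteq> 0"
  obtains m :: nat where "f z = 0 \<Longrightarrow> m > 0"
    "((\<lambda>x. of_real x * (deriv f (z + of_real x) / f (z + of_real x))) \<longlongrightarrow> of_nat m) (at_right 0)"
    "eventually (\<lambda>x. f (z + of_real x) \<noteq> 0) (at_right 0)"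
proof -
  have tz: "((\<lambda>x. z + of_real x) \<longlongrightarrow> z) (at_right (0::real))"
    by (rule tendsto_eq_intros refl | simp)+
  have tx: "((\<lambda>x. of_real x) \<longlongrightarrow> (0::complex)) (at_right (0::real))"
    by (rule tendsto_eq_intros refl | simp)+
  show thesis
  proof (cases "f z = 0")
    case False
    have "isCont f z" "isCont (deriv f) z"
      using f S by (metis continuous_on_eq_continuous_at holomorphic_on_imp_continuous_on holomorphic_deriv)+
    then have lim: "((\<lambda>x. f (z + of_real x)) \<longlongrightarrow> f z) (at_right 0)"
      "((\<lambda>x. deriv f (z + of_real x)) \<longlongrightarrow> deriv f z) (at_right 0)"
      using tz by (auto intro: isCont_tendsto_compose)
    have "((\<lambda>x. of_real x * (deriv f (z + of_real x) / f (z + of_real x))) \<longlongrightarrow> 0 * (deriv f z / f z)) (at_right 0)"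
      using False by (intro tendsto_mult tendsto_divide tx lim) auto
    then show thesis
      using that[of 0] tendsto_imp_eventually_ne[OF lim(1) False] False by simp
  next
    case True
    have "\<not> f constant_on S" using True nz S(3) by (metis constant_on_def)
    then obtain g r n where g: "0 < n" "0 < r" "ball z r \<subseteq> S" "g holomorphic_on ball z r"
      "\<And>w. w \<in> ball z r \<Longrightarrow> f w = (w - z)^n * g w" "\<And>w. w \<in> ball z r \<Longrightarrow> g w \<noteq> 0"
      using holomorphic_factor_zero_nonconstant[OF f S True] by metis
    have "isCont g z" "isCont (deriv g) z"
      using g(2,4) by (metis open_ball centre_in_ball continuous_on_eq_continuous_at
          holomorphic_on_imp_continuous_on holomorphic_deriv)+
    then have lim: "((\<lambda>x. g (z + of_real x)) \<longlongrightarrow> g z) (at_right 0)"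
      "((\<lambda>x. deriv g (z + of_real x)) \<longlongrightarrow> deriv g z) (at_right 0)"
      using tz by (auto intro: isCont_tendsto_compose)
    have ev: "eventually (\<lambda>x::real. 0 < x \<and> x < r) (at_right 0)"
      using g(2) eventually_at_right[of 0 1 "\<lambda>x. 0 < x \<and> x < r"] by (auto simp: eventually_at_right_field)
    have eq: "f (z + of_real x) \<noteq> 0"
       "of_real x * (deriv f (z + of_real x) / f (z + of_real x))
        = of_nat n + of_real x * (deriv g (z + of_real x) / g (z + of_real x))"
      if x: "0 < x" "x < r" for x
    proof -
      define w where "w = z + of_real x"
      have w: "w \<in> ball z r" using x by (simp add: w_def dist_norm)
      have "(g has_field_derivative deriv g w) (at w)"
        using g(4) w by (intro holomorphic_derivI) auto
      then have "((\<lambda>w. (w - z)^n * g w) has_field_derivative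
          (of_nat n * (w - z)^(n - 1) * g w + (w - z)^n * deriv g w)) (at w)"
        by (auto intro!: derivative_eq_intros)
      then have "(f has_field_derivative
          (of_nat n * (w - z)^(n - 1) * g w + (w - z)^n * deriv g w)) (at w)"
        by (rule has_field_derivative_transform_within_open[OF _ open_ball w]) (simp add: g(5))
      then have d: "deriv f w = of_nat n * (w - z)^(n - 1) * g w + (w - z)^n * deriv g w"
        by (rule DERIV_imp_deriv)
      have wz: "w - z = of_real x" "w - z \<noteq> 0" using x by (auto simp: w_def)
      show "f (z + of_real x) \<noteq> 0"
        using g(5,6)[OF w] wz by (simp add: w_def)
      have "(w - z) * (w - z)^(n - 1) = (w - z)^n"
        using g(1) by (simp flip: power_Suc)
      then have "(w - z) * deriv f w = (w - z)^n * (of_nat n * g w + (w - z) * deriv g w)"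
        unfolding d by (simp add: algebra_simps)
      then have "(w - z) * (deriv f w / f w) = of_nat n + (w - z) * (deriv g w / g w)"
        using g(5,6)[OF w] wz(2) by (simp add: add_divide_distrib)
      then show "of_real x * (deriv f (z + of_real x) / f (z + of_real x))
        = of_nat n + of_real x * (deriv g (z + of_real x) / g (z + of_real x))"
        unfolding wz(1) by (simp add: w_def)
    qed
    have "((\<lambda>x. of_nat n + of_real x * (deriv g (z + of_real x) / g (z + of_real x))) \<longlongrightarrow>
        of_nat n + 0 * (deriv g z / g z)) (at_right 0)"
      using g(2,6) by (intro tendsto_intros tx lim) auto
    moreover have "eventually (\<lambda>x. of_nat n + of_real x * (deriv g (z + of_real x) / g (z + of_real x))
        = of_real x * (deriv f (z + of_real x) / f (z + of_real x))) (at_right 0)"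
      using ev by eventually_elim (use eq in auto)
    ultimately have "((\<lambda>x. of_real x * (deriv f (z + of_real x) / f (z + of_real x))) \<longlongrightarrow> of_nat n) (at_right 0)"
      by (simp add: tendsto_cong)
    moreover have "eventually (\<lambda>x. f (z + of_real x) \<noteq> 0) (at_right 0)"
      using ev by eventually_elim (use eq in auto)
    ultimately show thesis using that[of n] g(1) by blast
  qed
qed

text \<open>The residue of minus zeta'/zeta: the pole of zeta at 1 contributes 1, and a zero of
  \<open>zeta_reg\<close> of order \<open>m\<close> contributes \<open>- m\<close>.\<close>

lemma mangoldt_series_limit:
  assumes s: "Re s \<ge> 1"
  obtains m :: nat where "zeta_reg s = 0 \<Longrightarrow> m > 0"
    "((\<lambda>x. of_real x * mangoldt_series (s + of_real x)) \<longlongrightarrow> (if s = 1 then 1 else 0) - of_nat m) (at_right 0)"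
proof -
  have conn: "connected {s. Re s > 0}" by (intro convex_connected convex_halfspace_Re_gt)
  obtain m :: nat where m: "zeta_reg s = 0 \<Longrightarrow> m > 0"
    "((\<lambda>x. of_real x * (deriv zeta_reg (s + of_real x) / zeta_reg (s + of_real x))) \<longlongrightarrow> of_nat m) (at_right 0)"
    "eventually (\<lambda>x. zeta_reg (s + of_real x) \<noteq> 0) (at_right 0)"
    using log_deriv_limit[OF holomorphic_zeta_reg open_halfspace_Re_gt conn, of s 1] s by auto
  have tx: "((\<lambda>x. of_real x) \<longlongrightarrow> (0::complex)) (at_right (0::real))"
    by (rule tendsto_eq_intros refl | simp)+
  have "((\<lambda>x. of_real x / (s + of_real x - 1)) \<longlongrightarrow> (if s = 1 then 1 else 0)) (at_right (0::real))"
  proof (cases "s = 1")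
    case True
    have "eventually (\<lambda>x::real. of_real x / (s + of_real x - 1) = 1) (at_right 0)"
      using eventually_at_right_less[of 0] by eventually_elim (simp add: True)
    then show ?thesis using True by (simp add: tendsto_eventually)
  next
    case False
    have "((\<lambda>x. of_real x / (s + of_real x - 1)) \<longlongrightarrow> 0 / (s + 0 - 1)) (at_right (0::real))"
      using False by (intro tendsto_intros tx) auto
    then show ?thesis using False by simp
  qed
  from tendsto_diff[OF this m(2)]
  have lim: "((\<lambda>x. of_real x / (s + of_real x - 1) - of_real x * (deriv zeta_reg (s + of_real x) / zeta_reg (s + of_real x)))
     \<longlongrightarrow> (if s = 1 then 1 else 0) - of_nat m) (at_right 0)" .
  have "eventually (\<lambda>x. of_real x / (s + of_real x - 1) - of_real x * (deriv zeta_reg (s + of_real x) / zeta_reg (s + of_real x))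
     = of_real x * mangoldt_series (s + of_real x)) (at_right 0)"
    using m(3) eventually_at_right_less[of 0]
  proof eventually_elim
    case (elim x)
    then have "Re (s + of_real x) > 1" using s by simp
    from deriv_zeta_reg[OF this] elim
    have "deriv zeta_reg (s + of_real x) / zeta_reg (s + of_real x) = 1 / (s + of_real x - 1) - mangoldt_series (s + of_real x)"
      by simp
    then show ?case by (simp only: right_diff_distrib) simp
  qed
  with lim have "((\<lambda>x. of_real x * mangoldt_series (s + of_real x)) \<longlongrightarrow> (if s = 1 then 1 else 0) - of_nat m) (at_right 0)"
    using tendsto_cong by fast
  with m(1) show thesis by (rule that)
qed

text \<open>The real part of the n-th term at \<open>Complex a u\<close> is
  \<open>mangoldt n * n powr - a * cos (u * ln n)\<close>, so the combination has nonnegative terms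
  because \<open>3 + 4 * cos x + cos (2 * x) = 2 * (1 + cos x)^2\<close>.\<close>

lemma mangoldt_series_3_4_1:
  assumes a: "a > 1"
  shows "3 * Re (mangoldt_series (of_real a)) + 4 * Re (mangoldt_series (Complex a t))
    + Re (mangoldt_series (Complex a (2 * t))) \<ge> 0"
proof -
  have sums: "(\<lambda>n. mangoldt n * real n powr - a * cos (u * ln (real n))) sums Re (mangoldt_series (Complex a u))" for u
  proof -
    have "summable (\<lambda>n. mangoldt n * of_nat n powr - Complex a u :: complex)"
      using a by (intro summable_norm_cancel[OF summable_norm_mangoldt_series]) simp
    then have "(\<lambda>n. Re (mangoldt n * of_nat n powr - Complex a u :: complex)) sums Re (mangoldt_series (Complex a u))"
      unfolding mangoldt_series_def by (intro sums_Re summable_sums)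
    moreover have "Re (mangoldt n * of_nat n powr - Complex a u :: complex) = mangoldt n * real n powr - a * cos (u * ln (real n))" for n
      by (cases "n = 0") (auto simp: powr_def Re_exp mult.commute)
    ultimately show ?thesis by (simp only:)
  qed
  have "0 \<le> mangoldt n * real n powr - a * (3 + 4 * cos (t * ln (real n)) + cos (2 * t * ln (real n)))" for n
  proof -
    have "3 + 4 * cos x + cos (2 * x) = 2 * (1 + cos x)\<^sup>2" for x :: real
      unfolding cos_double_cos by (simp add: power2_eq_square algebra_simps)
    then have "3 + 4 * cos x + cos (2 * x) \<ge> 0" for x :: real by simp
    from this[of "t * ln (real n)"] show ?thesis
      by (intro mult_nonneg_nonneg mangoldt_nonneg) (auto simp: mult.assoc)
  qed
  moreover have "(\<lambda>n. mangoldt n * real n powr - a * (3 + 4 * cos (t * ln (real n)) + cos (2 * t * ln (real n))))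
      sums (3 * Re (mangoldt_series (of_real a)) + 4 * Re (mangoldt_series (Complex a t))
       + Re (mangoldt_series (Complex a (2 * t))))"
    using sums_add[OF sums_add[OF sums_mult[OF sums[of 0], of 3] sums_mult[OF sums[of t], of 4]] sums[of "2 * t"]]
    by (simp add: algebra_simps complex_of_real_def)
  ultimately show ?thesis by (rule sums_le[OF _ sums_zero])
qed

text \<open>
  If \<open>m\<close> and \<open>m'\<close> are the orders of vanishing at \<open>s\<close> and \<open>s + i Im s\<close>, the 3-4-1 inequality
  forces \<open>3 - 4m - m' \<ge> 0\<close>.
\<close>

lemma zeta_reg_nonzero:
  assumes s: "Re s \<ge> 1"
  shows "zeta_reg s \<noteq> 0"
proof
  assume zero: "zeta_reg s = 0"
  define s2 where "s2 = Complex (Re s) (2 * Im s)"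
  \<comment> \<open>The pole contribution 1 is thereby excluded at \<open>s\<close> and
    \<open>s2\<close>; it can occur only at the real point \<open>Re s\<close>, where it is counted
    three times against at least four from the zero.\<close>
  have "s \<noteq> 1" using zero by auto
  then have "s2 \<noteq> 1" by (auto simp: s2_def complex_eq_iff)
  obtain m1 :: nat where m1: "m1 > 0"
    "((\<lambda>x. of_real x * mangoldt_series (s + of_real x)) \<longlongrightarrow> - of_nat m1) (at_right 0)"
    using mangoldt_series_limit[OF s] zero \<open>s \<noteq> 1\<close> by auto
  obtain m2 :: nat where m2:
    "((\<lambda>x. of_real x * mangoldt_series (s2 + of_real x)) \<longlongrightarrow> - of_nat m2) (at_right 0)"
    using mangoldt_series_limit[of s2] s \<open>s2 \<noteq> 1\<close> by (auto simp: s2_def)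
  obtain m0 :: nat where m0:
    "((\<lambda>x. of_real x * mangoldt_series (of_real (Re s) + of_real x)) \<longlongrightarrow>
      (if of_real (Re s) = (1 :: complex) then 1 else 0) - of_nat m0) (at_right 0)"
    using mangoldt_series_limit[of "of_real (Re s)"] s by auto
  have "((\<lambda>x. 3 * Re (of_real x * mangoldt_series (of_real (Re s) + of_real x))
      + 4 * Re (of_real x * mangoldt_series (s + of_real x))
      + Re (of_real x * mangoldt_series (s2 + of_real x))) \<longlongrightarrow>
     3 * Re ((if of_real (Re s) = (1 :: complex) then 1 else 0) - of_nat m0) + 4 * Re (- of_nat m1) + Re (- of_nat m2)) (at_right 0)"
    by (intro tendsto_intros m0 m1 m2)
  moreover have "eventually (\<lambda>x. 0 \<le> 3 * Re (of_real x * mangoldt_series (of_real (Re s) + of_real x))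
      + 4 * Re (of_real x * mangoldt_series (s + of_real x))
      + Re (of_real x * mangoldt_series (s2 + of_real x))) (at_right 0)"
    using eventually_at_right_less[of 0]
  proof eventually_elim
    case (elim x)
    have eqs: "s + of_real x = Complex (Re s + x) (Im s)" "s2 + of_real x = Complex (Re s + x) (2 * Im s)"
      "of_real (Re s) + of_real x = complex_of_real (Re s + x)"
      by (simp_all add: s2_def complex_eq_iff)
    have "0 \<le> x * (3 * Re (mangoldt_series (of_real (Re s + x))) + 4 * Re (mangoldt_series (Complex (Re s + x) (Im s)))
      + Re (mangoldt_series (Complex (Re s + x) (2 * Im s))))"
      using elim s by (intro mult_nonneg_nonneg mangoldt_series_3_4_1) auto
    then show ?case unfolding eqs by (simp add: algebra_simps)
  qed
  ultimately have "0 \<le> 3 * Re ((if of_real (Re s) = (1 :: complex) then 1 else 0) - of_nat m0) + 4 * Re (- of_nat m1) + Re (- of_nat m2)"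
    by (rule tendsto_lowerbound) simp
  then show False using m1(1) by (auto split: if_splits)
qed

section \<open>A Tauberian theorem\<close>

text \<open>The Fourier transform of the triangle \<open>1 - \<bar>u\<bar> / l\<close> on
  \<open>[-l, l]\<close>, as \<open>has_integral_fejer\<close> shows. The value \<open>l\<close> at
  0 is the continuous extension.\<close>

definition fejer :: "real \<Rightarrow> real \<Rightarrow> real" where
  "fejer l v = (if v = 0 then l else 2 * (1 - cos (l * v)) / (l * v\<^sup>2))"

lemma fejer_eq_sin: "v \<noteq> 0 \<Longrightarrow> fejer l v = 4 * (sin (l * v / 2))\<^sup>2 / (l * v\<^sup>2)"
  using cos_double_sin[of "l * v / 2"] by (simp add: fejer_def)

lemma measurable_fejer [measurable]: "fejer l \<in> borel_measurable borel"
  unfolding fejer_def by measurable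

lemma fejer_nonneg: "l > 0 \<Longrightarrow> 0 \<le> fejer l v"
  by (simp add: fejer_def)

lemma fejer_le:
  assumes "l > 0"
  shows "fejer l v \<le> l"
proof (cases "v = 0")
  case False
  have "(sin (l * v / 2))\<^sup>2 \<le> (l * v / 2)\<^sup>2"
    by (rule abs_le_square_iff[THEN iffD1, OF abs_sin_x_le_abs_x])
  then have "4 * (sin (l * v / 2))\<^sup>2 \<le> l * (l * v\<^sup>2)"
    by (simp add: power_divide power_mult_distrib power2_eq_square[of l])
  then show ?thesis using assms False by (simp add: fejer_eq_sin pos_divide_le_eq)
qed (simp add: fejer_def)

lemma fejer_tail_le:
  assumes "l > 0" "v \<noteq> 0"
  shows "fejer l v \<le> 4 / (l * v\<^sup>2)"
proof -
  have "(sin (l * v / 2))\<^sup>2 \<le> 1" by (simp add: abs_square_le_1)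
  then show ?thesis using assms by (simp add: fejer_eq_sin divide_right_mono)
qed

text \<open>For \<open>0 <= y <= 1/2\<close> the Maclaurin bound gives
  \<open>sin y >= 3/4 * y\<close>; squaring yields the factor 9/16, rounded down to 1/2.\<close>

lemma fejer_center_ge:
  assumes "l > 0" "\<bar>v\<bar> \<le> 1 / l"
  shows "fejer l v \<ge> l / 2"
proof (cases "v = 0")
  case False
  define y where "y = \<bar>l * v / 2\<bar>"
  have y: "0 \<le> y" "y \<le> 1/2" using assms by (auto simp: y_def abs_mult field_simps)
  have "\<bar>sin y - y\<bar> \<le> y ^ 3 / 6"
    using Maclaurin_sin_bound[of y 3] y by (simp add: numeral_eq_Suc sin_coeff_def)
  moreover have "y ^ 3 / 6 \<le> y / 4"
  proof -
    have "y ^ 3 = y * y\<^sup>2" by (simp add: power_numeral_reduce)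
    also have "\<dots> \<le> y * 1" using y by (intro mult_left_mono) (auto simp: abs_square_le_1)
    finally show ?thesis using y by simp
  qed
  ultimately have "sin y \<ge> 3 / 4 * y" by linarith
  then have "(3 / 4 * y)\<^sup>2 \<le> (sin y)\<^sup>2" using y by (intro power_mono) auto
  moreover have "(sin y)\<^sup>2 = (sin (l * v / 2))\<^sup>2" by (simp add: y_def abs_if)
  moreover have "y\<^sup>2 = (l * v)\<^sup>2 / 4" by (simp add: y_def power_divide)
  ultimately have "9 / 16 * ((l * v)\<^sup>2 / 4) \<le> (sin (l * v / 2))\<^sup>2"
    unfolding power_mult_distrib[of "3/4" y] by (simp add: power_divide)
  moreover have "0 \<le> (l * v)\<^sup>2" by simp
  ultimately have "(l * v)\<^sup>2 / 8 \<le> (sin (l * v / 2))\<^sup>2" by linarith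
  then have "l / 2 * (l * v\<^sup>2) \<le> 4 * (sin (l * v / 2))\<^sup>2"
    by (simp add: power_mult_distrib power2_eq_square[of l])
  then show ?thesis using assms False by (simp add: fejer_eq_sin pos_le_divide_eq)
qed (use assms in \<open>simp add: fejer_def\<close>)

text \<open>The Cauchy density is the common majorant for the kernel and its tails; its integral is
  the source of the factor \<open>pi\<close> in the bounds below.\<close>

lemma integrable_cauchy: "integrable lborel (\<lambda>v::real. inverse (1 + v\<^sup>2))"
  and integral_cauchy: "(LINT v|lborel. inverse (1 + v\<^sup>2)) = pi"
  using integrable_inverse_1_plus_square LBINT_inverse_1_plus_square
  by (simp_all add: set_integrable_def interval_lebesgue_integral_def set_lebesgue_integral_def)

lemma integrable_fejer:
  assumes "l > 0"
  shows "integrable lborel (fejer l)"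
proof (rule Bochner_Integration.integrable_bound)
  show "integrable lborel (\<lambda>v. (l + 4 / l) * inverse (1 + v\<^sup>2))"
    using integrable_cauchy by simp
  \<comment> \<open>Adding this to \<open>fejer l v <= l\<close> bounds
    \<open>fejer l v * (1 + v^2)\<close>, which covers the centre and the tail at once.\<close>
  have "fejer l v * v\<^sup>2 \<le> 4 / l" for v
    using fejer_tail_le[OF assms, of v] assms
    by (cases "v = 0") (auto simp: pos_le_divide_eq mult.commute mult.left_commute)
  then have "fejer l v * (1 + v\<^sup>2) \<le> l + 4 / l" for v
    using fejer_le[OF assms, of v] by (simp only: distrib_left mult_1_right add_mono)
  moreover have "1 + v\<^sup>2 > 0" for v :: real by (simp add: add_pos_nonneg)
  ultimately have "fejer l v \<le> (l + 4 / l) * inverse (1 + v\<^sup>2)" for v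
    by (metis pos_le_divide_eq divide_inverse)
  then show "AE v in lborel. norm (fejer l v) \<le> norm ((l + 4 / l) * inverse (1 + v\<^sup>2))"
    using fejer_nonneg[OF assms] by (auto intro!: AE_I2 order_trans[OF _ abs_ge_self])
qed simp

lemma integrable_fejer_shift:
  assumes "l > 0"
  shows "integrable lborel (\<lambda>t. fejer l (y - t))"
  using lborel_integrable_real_affine[OF integrable_fejer[OF assms], of "-1" y] by simp

text \<open>For \<open>v = 0\<close> this is the area of the triangle. Otherwise each half of
  \<open>[-l, l]\<close> has an explicit antiderivative, found by parts; the boundary terms with
  denominator \<open>\<i> * v\<close> vanish at the ends and cancel at 0.\<close>

lemma has_integral_fejer:
  assumes l: "l > 0"
  shows "((\<lambda>u. of_real (1 - \<bar>u\<bar> / l) * exp (\<i> * of_real u * of_real v)) has_integral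
           complex_of_real (fejer l v)) {-l..l}"
proof (cases "v = 0")
  case True
  have "((\<lambda>u. 1 - \<bar>u\<bar> / l) has_integral (l / 2 + l / 2)) {-l..l}"
  proof (rule has_integral_combine[of _ 0])
    have "((\<lambda>u. 1 + u / l) has_integral ((0 + 0\<^sup>2 / (2 * l)) - (- l + (-l)\<^sup>2 / (2 * l)))) {-l..0}"
      using l by (intro fundamental_theorem_of_calculus)
        (auto intro!: derivative_eq_intros simp flip: has_real_derivative_iff_has_vector_derivative)
    then show "((\<lambda>u. 1 - \<bar>u\<bar> / l) has_integral (l / 2)) {-l..0}"
      using l by (subst has_integral_cong[where g = "\<lambda>u. 1 + u / l"]) (auto simp: power2_eq_square field_simps)
    have "((\<lambda>u. 1 - u / l) has_integral ((l - l\<^sup>2 / (2 * l)) - (0 - 0\<^sup>2 / (2 * l)))) {0..l}"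
      using l by (intro fundamental_theorem_of_calculus)
        (auto intro!: derivative_eq_intros simp flip: has_real_derivative_iff_has_vector_derivative)
    then show "((\<lambda>u. 1 - \<bar>u\<bar> / l) has_integral (l / 2)) {0..l}"
      using l by (subst has_integral_cong[where g = "\<lambda>u. 1 - u / l"]) (auto simp: power2_eq_square field_simps)
  qed (use l in auto)
  from has_integral_of_real[OF this, where 'b = complex] show ?thesis
    using True l by (simp add: fejer_def)
next
  case False
  let ?e = "\<lambda>u. exp (\<i> * of_real u * of_real v) :: complex"
  have de: "(?e has_vector_derivative \<i> * of_real v * ?e u) (at u within S)" for u S
  proof -
    have "((\<lambda>z. exp (\<i> * z * of_real v)) has_field_derivative \<i> * of_real v * exp (\<i> * of_real u * of_real v)) (at (of_real u))"
      by (auto intro!: derivative_eq_intros)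
    from has_vector_derivative_real_field[OF this] show ?thesis
      by (rule has_vector_derivative_at_within)
  qed
  \<comment> \<open>With \<open>c = 1\<close> and \<open>c = -1\<close> this serves the left and the
    right half of the triangle.\<close>
  have dl: "((\<lambda>u. complex_of_real (1 + c * u / l)) has_vector_derivative of_real (c / l)) (at u within S)" for c u S
    using l by (intro has_vector_derivative_of_real)
       (auto intro!: derivative_eq_intros simp flip: has_real_derivative_iff_has_vector_derivative)
  have nz: "complex_of_real v \<noteq> 0" "complex_of_real l \<noteq> 0" using False l by auto
  have "((\<lambda>u. of_real (1 - \<bar>u\<bar> / l) * ?e u) has_integral
     ((of_real (1 + 1 * 0 / l) * ?e 0 / (\<i> * of_real v) + ?e 0 / (of_real l * of_real v ^ 2))
      - (of_real (1 + 1 * (-l) / l) * ?e (-l) / (\<i> * of_real v) + ?e (-l) / (of_real l * of_real v ^ 2)))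
   + ((of_real (1 + (-1) * l / l) * ?e l / (\<i> * of_real v) - ?e l / (of_real l * of_real v ^ 2))
      - (of_real (1 + (-1) * 0 / l) * ?e 0 / (\<i> * of_real v) - ?e 0 / (of_real l * of_real v ^ 2)))) {-l..l}"
    (is "(_ has_integral (?P1 0 - ?P1 (-l)) + (?P2 l - ?P2 0)) _")
  proof (rule has_integral_combine[of _ 0])
    have "((\<lambda>u. of_real (1 + 1 * u / l) * ?e u) has_integral (?P1 0 - ?P1 (-l))) {-l..0}"
    proof (intro fundamental_theorem_of_calculus)
      fix u assume "u \<in> {-l..0}"
      show "(?P1 has_vector_derivative of_real (1 + 1 * u / l) * ?e u) (at u within {-l..0})"
        using nz
        by (intro has_vector_derivative_eq_rhs[OF has_vector_derivative_add[OF has_vector_derivative_divide[OF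
              has_vector_derivative_mult[OF dl de]] has_vector_derivative_divide[OF de]]])
           (simp add: divide_simps power2_eq_square, simp add: algebra_simps)
    qed (use l in auto)
    then show "((\<lambda>u. of_real (1 - \<bar>u\<bar> / l) * ?e u) has_integral (?P1 0 - ?P1 (-l))) {-l..0}"
      by (subst has_integral_cong[where g = "\<lambda>u. of_real (1 + 1 * u / l) * ?e u"]) auto
    have "((\<lambda>u. of_real (1 + (-1) * u / l) * ?e u) has_integral (?P2 l - ?P2 0)) {0..l}"
    proof (intro fundamental_theorem_of_calculus)
      fix u assume "u \<in> {0..l}"
      show "(?P2 has_vector_derivative of_real (1 + (-1) * u / l) * ?e u) (at u within {0..l})"
        using nz
        by (intro has_vector_derivative_eq_rhs[OF has_vector_derivative_diff[OF has_vector_derivative_divide[OF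
              has_vector_derivative_mult[OF dl de]] has_vector_derivative_divide[OF de]]])
           (simp add: divide_simps power2_eq_square, simp add: algebra_simps)
    qed (use l in auto)
    then show "((\<lambda>u. of_real (1 - \<bar>u\<bar> / l) * ?e u) has_integral (?P2 l - ?P2 0)) {0..l}"
      by (subst has_integral_cong[where g = "\<lambda>u. of_real (1 + (-1) * u / l) * ?e u"]) auto
  qed (use l in auto)
  also have "(?P1 0 - ?P1 (-l)) + (?P2 l - ?P2 0) = (2 - (?e l + ?e (-l))) / (of_real l * of_real v ^ 2)"
    using l by (simp add: diff_divide_distrib add_divide_distrib)
  also have "?e l + ?e (-l) = of_real (2 * cos (l * v))"
    using cos_exp_eq[of "of_real (l * v)"] by (simp add: mult_ac flip: cos_of_real)
  also have "(2 - of_real (2 * cos (l * v))) / (of_real l * of_real v ^ 2) = complex_of_real (fejer l v)"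
    using False by (simp add: fejer_def right_diff_distrib)
  finally show ?thesis .
qed

text \<open>One integration by parts gains a factor \<open>1 / y\<close>. The constant
  \<open>K\<close> collects the two boundary values and the supremum of \<open>f'\<close> times the
  length of the interval.\<close>

lemma riemann_lebesgue_C1:
  fixes f :: "real \<Rightarrow> complex"
  assumes ab: "a \<le> b"
    and f: "\<And>u. u \<in> {a..b} \<Longrightarrow> (f has_vector_derivative f' u) (at u within {a..b})"
    and f': "continuous_on {a..b} f'"
  shows "((\<lambda>y. integral {a..b} (\<lambda>u. f u * exp (\<i> * of_real u * of_real y))) \<longlongrightarrow> 0) at_top"
proof -
  have "bounded (f' ` {a..b})"
    by (rule compact_imp_bounded[OF compact_continuous_image[OF f' compact_Icc]])
  then obtain M where M: "\<And>u. u \<in> {a..b} \<Longrightarrow> cmod (f' u) \<le> M"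
    unfolding bounded_iff by blast
  define K where "K = cmod (f a) + cmod (f b) + M * (b - a)"
  have bound: "cmod (integral {a..b} (\<lambda>u. f u * exp (\<i> * of_real u * of_real y))) \<le> K / y" if y: "y > 0" for y
  proof -
    let ?e = "\<lambda>u. exp (\<i> * of_real u * of_real y) :: complex"
    have ne: "cmod (?e u) = 1" for u by (simp add: norm_exp_eq_Re)
    have de: "(?e has_vector_derivative \<i> * of_real y * ?e u) (at u within S)" for u S
    proof -
      have "((\<lambda>z. exp (\<i> * z * of_real y)) has_field_derivative \<i> * of_real y * exp (\<i> * of_real u * of_real y)) (at (of_real u))"
        by (auto intro!: derivative_eq_intros)
      from has_vector_derivative_real_field[OF this] show ?thesis
        by (rule has_vector_derivative_at_within)
    qed
    have ce: "continuous_on {a..b} ?e" by (intro continuous_intros)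
    have "((\<lambda>u. f u * (\<i> * of_real y * ?e u) + f' u * ?e u) has_integral (f b * ?e b - f a * ?e a)) {a..b}"
      using ab f by (intro fundamental_theorem_of_calculus) (auto intro!: has_vector_derivative_mult de)
    moreover have i1: "(\<lambda>u. f' u * ?e u) integrable_on {a..b}"
      by (intro integrable_continuous_interval continuous_intros ce f')
    then have "((\<lambda>u. f' u * ?e u) has_integral integral {a..b} (\<lambda>u. f' u * ?e u)) {a..b}"
      by (rule integrable_integral)
    ultimately have "((\<lambda>u. f u * (\<i> * of_real y * ?e u)) has_integral
       (f b * ?e b - f a * ?e a - integral {a..b} (\<lambda>u. f' u * ?e u))) {a..b}"
      by (rule has_integral_diff[where f = "\<lambda>u. f u * (\<i> * of_real y * ?e u) + f' u * ?e u" and g = "\<lambda>u. f' u * ?e u", simplified])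
    from has_integral_mult_right[OF this, of "1 / (\<i> * of_real y)"]
    have "integral {a..b} (\<lambda>u. f u * ?e u)
      = 1 / (\<i> * of_real y) * (f b * ?e b - f a * ?e a - integral {a..b} (\<lambda>u. f' u * ?e u))"
      using y by (intro integral_unique) (simp add: field_simps)
    then have "cmod (integral {a..b} (\<lambda>u. f u * ?e u))
       = cmod (f b * ?e b - f a * ?e a - integral {a..b} (\<lambda>u. f' u * ?e u)) / y"
      using y by (simp add: norm_mult norm_divide)
    also have "\<dots> \<le> K / y"
    proof (rule divide_right_mono)
      have "cmod (integral {a..b} (\<lambda>u. f' u * ?e u)) \<le> M * (b - a)"
        using ab M by (intro integral_bound continuous_on_mult f' ce) (auto simp: norm_mult ne)
      then show "cmod (f b * ?e b - f a * ?e a - integral {a..b} (\<lambda>u. f' u * ?e u)) \<le> K"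
        unfolding K_def using norm_triangle_ineq4[of "f b * ?e b - f a * ?e a" "integral {a..b} (\<lambda>u. f' u * ?e u)"]
          norm_triangle_ineq4[of "f b * ?e b" "f a * ?e a"] ne[of a] ne[of b]
        by (simp only: norm_mult)
    qed (use y in auto)
    finally show ?thesis .
  qed
  have "((\<lambda>y. K / y) \<longlongrightarrow> 0) at_top"
    by (intro tendsto_divide_0[OF tendsto_const] filterlim_at_top_imp_at_infinity filterlim_ident)
  then show ?thesis
    by (rule Lim_null_comparison[rotated]) (rule eventually_mono[OF eventually_gt_at_top[of 0] bound])
qed

section \<open>Smoothing with the Fejer kernel\<close>

lemma integrable_exp_decay:
  fixes h :: "real \<Rightarrow> real"
  assumes h: "h \<in> borel_measurable borel" "\<And>t. \<bar>h t\<bar> \<le> C" "\<And>t. t < 0 \<Longrightarrow> h t = 0" and e: "e > 0"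
  shows "integrable lborel (\<lambda>t. h t * exp (- (e * t)))"
proof (rule Bochner_Integration.integrable_bound)
  have "integrable lborel (\<lambda>t. indicator {0<..} t *\<^sub>R exp (- (t * e)))"
    using integrable_I0i_exp_mscale[OF e] by (simp add: set_integrable_def)
  then show "integrable lborel (\<lambda>t. C * (indicator {0<..} t *\<^sub>R exp (- (t * e))))" by simp
  show "(\<lambda>t. h t * exp (- (e * t))) \<in> borel_measurable lborel" using h(1) by simp
  \<comment> \<open>The majorant lives on the open half-line, while \<open>h 0\<close> may be
    nonzero.\<close>
  have "AE t in lborel. t \<noteq> (0::real)" by (rule AE_lborel_singleton)
  then show "AE t in lborel. norm (h t * exp (- (e * t))) \<le> norm (C * (indicator {0<..} t *\<^sub>R exp (- (t * e))))"
  proof eventually_elim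
    case (elim t)
    have "C \<ge> 0" using h(2)[of 0] by linarith
    then show ?case
      using h(2)[of t] h(3)[of t] elim by (cases "t < 0") (auto simp: abs_mult mult.commute intro!: mult_right_mono)
  qed
qed

text \<open>Replace the kernel by its triangle integral and apply Fubini. The damping
  \<open>e > 0\<close> makes \<open>h t * exp (- (e * t))\<close> integrable and moves the Laplace
  transform to the line \<open>Re z = e\<close>.\<close>

lemma fejer_smoothing_damped:
  fixes h :: "real \<Rightarrow> real"
  assumes h: "h \<in> borel_measurable borel" "\<And>t. \<bar>h t\<bar> \<le> C" "\<And>t. t < 0 \<Longrightarrow> h t = 0"
    and e: "e > 0" and l: "l > 0"
  shows "complex_of_real (LINT t|lborel. h t * exp (- (e * t)) * fejer l (y - t)) =
    (LINT u|lborel. indicator {-l..l} u *\<^sub>R (of_real (1 - \<bar>u\<bar> / l) * exp (\<i> * of_real u * of_real y) *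
       (LINT t|lborel. of_real (h t) * exp (- (Complex e u) * of_real t))))"
proof -
  define k where "k = (\<lambda>u. indicator {-l..l} u * (1 - \<bar>u\<bar> / l))"
  have k_meas [measurable]: "k \<in> borel_measurable borel" unfolding k_def by measurable
  note [measurable] = h(1)
  have hint: "integrable lborel (\<lambda>t. h t * exp (- (e * t)))"
    by (rule integrable_exp_decay[OF h e])
  have kint: "integrable lborel k"
  proof -
    have "continuous_on {-l..l} (\<lambda>u. 1 - \<bar>u\<bar> / l)" using l by (intro continuous_intros) auto
    then show ?thesis
      using borel_integrable_compact[of "{-l..l}" "\<lambda>u. 1 - \<bar>u\<bar> / l"] by (simp add: k_def)
  qed
  define f where "f = (\<lambda>t u. of_real (h t * exp (- (e * t))) * (of_real (k u) * exp (\<i> * of_real u * of_real (y - t))) :: complex)"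
  have nf: "norm (f t u) = \<bar>h t * exp (- (e * t))\<bar> * \<bar>k u\<bar>" for t u
    by (simp only: f_def norm_mult norm_of_real) (simp add: norm_exp_eq_Re)
  have f_meas: "case_prod f \<in> borel_measurable (lborel \<Otimes>\<^sub>M lborel)"
    unfolding f_def by measurable
  have int_f: "integrable (lborel \<Otimes>\<^sub>M lborel) (case_prod f)"
  proof (rule lborel_pair.Fubini_integrable[OF f_meas])
    show "integrable lborel (\<lambda>t. LINT u|lborel. norm (case_prod f (t, u)))"
      using integrable_abs[OF hint] by (simp add: nf)
    have "integrable lborel (f t)" for t
    proof (rule Bochner_Integration.integrable_bound)
      show "integrable lborel (\<lambda>u. \<bar>h t * exp (- (e * t))\<bar> * \<bar>k u\<bar>)" using kint by simp
      show "f t \<in> borel_measurable lborel" unfolding f_def by measurable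
    qed (simp add: nf abs_mult)
    then show "AE t in lborel. integrable lborel (\<lambda>u. case_prod f (t, u))" by simp
  qed
  have fej: "(LINT u|lborel. of_real (k u) * exp (\<i> * of_real u * of_real v)) = complex_of_real (fejer l v)" for v
  proof -
    have "set_integrable lborel {-l..l} (\<lambda>u. of_real (1 - \<bar>u\<bar> / l) * exp (\<i> * of_real u * of_real v) :: complex)"
      unfolding set_integrable_def
      using l by (intro borel_integrable_compact continuous_intros) auto
    from set_borel_integral_eq_integral(2)[OF this] integral_unique[OF has_integral_fejer[OF l]]
    show ?thesis by (simp add: set_lebesgue_integral_def k_def scaleR_conv_of_real mult.assoc of_real_indicator)
  qed
  have "complex_of_real (LINT t|lborel. h t * exp (- (e * t)) * fejer l (y - t))
      = (LINT t|lborel. of_real (h t * exp (- (e * t)) * fejer l (y - t)))"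
    by (rule integral_complex_of_real[symmetric])
  also have "\<dots> = (LINT t|lborel. LINT u|lborel. f t u)"
    by (simp add: f_def fej del: of_real_diff)
  also have "\<dots> = (LINT u|lborel. LINT t|lborel. f t u)"
    by (rule lborel_pair.Fubini_integral[OF int_f, symmetric])
  also have "\<dots> = (LINT u|lborel. (of_real (k u) * exp (\<i> * of_real u * of_real y)) *
       (LINT t|lborel. of_real (h t) * exp (- (Complex e u) * of_real t)))"
  proof (rule Bochner_Integration.integral_cong[OF refl])
    fix u
    have "f t u = (of_real (k u) * exp (\<i> * of_real u * of_real y)) * (of_real (h t) * exp (- (Complex e u) * of_real t))" for t
    proof -
      have "exp (- (Complex e u) * of_real t) = exp (of_real (- (e * t))) * exp (- (\<i> * of_real u * of_real t))"
        unfolding exp_add[symmetric] by (simp add: Complex_eq algebra_simps)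
      moreover have "exp (\<i> * of_real u * of_real (y - t)) = exp (\<i> * of_real u * of_real y) * exp (- (\<i> * of_real u * of_real t))"
        unfolding exp_add[symmetric] by (simp add: algebra_simps)
      ultimately show ?thesis
        unfolding f_def by (simp only: of_real_mult exp_of_real mult_ac)
    qed
    then show "(LINT t|lborel. f t u) = (of_real (k u) * exp (\<i> * of_real u * of_real y)) *
       (LINT t|lborel. of_real (h t) * exp (- (Complex e u) * of_real t))"
      by (simp only: integral_mult_right_zero)
  qed
  finally show ?thesis
    by (simp add: k_def scaleR_conv_of_real mult.assoc of_real_indicator)
qed

text \<open>Let the damping tend to 0 in \<open>fejer_smoothing_damped\<close>. The left side is
  dominated by \<open>C\<close> times the shifted kernel, the right side by the bound
  \<open>M\<close> of \<open>G\<close> on a compact half-disc.\<close>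

lemma fejer_smoothing:
  fixes h :: "real \<Rightarrow> real" and G :: "complex \<Rightarrow> complex"
  assumes h: "h \<in> borel_measurable borel" "\<And>t. \<bar>h t\<bar> \<le> C" "\<And>t. t < 0 \<Longrightarrow> h t = 0"
    and G: "\<And>z. Re z > 0 \<Longrightarrow> G z = (LINT t|lborel. of_real (h t) * exp (- z * of_real t))"
    and cont: "continuous_on {z. Re z \<ge> 0} G" and l: "l > 0"
  shows "complex_of_real (LINT t|lborel. h t * fejer l (y - t)) =
    integral {-l..l} (\<lambda>u. of_real (1 - \<bar>u\<bar> / l) * G (\<i> * of_real u) * exp (\<i> * of_real u * of_real y))"
proof -
  define e where "e = (\<lambda>n. 1 / real (Suc n))"
  have e: "e n > 0" "e n \<le> 1" for n by (simp_all add: e_def field_simps)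
  have e0: "e \<longlonglongrightarrow> 0" unfolding e_def using LIMSEQ_Suc[OF lim_const_over_n[of 1]] by simp
  note [measurable] = h(1)
  have C0: "C \<ge> 0" using h(2)[of 0] by linarith
  \<comment> \<open>\<open>K\<close> contains all points \<open>Complex (e n) u\<close> with
    \<open>u\<close> in \<open>[-l, l]\<close>, so a single bound \<open>M\<close> serves for every
    \<open>n\<close>.\<close>
  define K where "K = cball (0::complex) (l + 1) \<inter> {z. Re z \<ge> 0}"
  have "compact K" unfolding K_def
    by (intro compact_Int_closed closed_halfspace_Re_ge compact_cball)
  moreover have "continuous_on K G" using cont by (rule continuous_on_subset) (auto simp: K_def)
  ultimately have "bounded (G ` K)" by (intro compact_imp_bounded compact_continuous_image)
  then obtain M where M: "\<And>z. z \<in> K \<Longrightarrow> cmod (G z) \<le> M" unfolding bounded_iff by blast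
  have inK: "Complex a u \<in> K" if "0 \<le> a" "a \<le> 1" "u \<in> {-l..l}" for a u
  proof -
    have "cmod (Complex a u) \<le> l + 1"
      using cmod_le[of "Complex a u"] that by auto
    then show ?thesis using that by (simp add: K_def)
  qed
  let ?g = "\<lambda>a u. indicator {-l..l} u *\<^sub>R (of_real (1 - \<bar>u\<bar> / l) * exp (\<i> * of_real u * of_real y) * G (Complex a u)) :: complex"
  have meas: "?g a \<in> borel_measurable borel" if "a \<ge> 0" for a
  proof -
    have "continuous_on {-l..l} (\<lambda>u. G (Complex a u))"
      by (rule continuous_on_compose2[OF cont]) (use that in \<open>auto intro!: continuous_intros\<close>)
    then have "set_integrable lborel {-l..l} (\<lambda>u. of_real (1 - \<bar>u\<bar> / l) * exp (\<i> * of_real u * of_real y) * G (Complex a u))"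
      unfolding set_integrable_def using l by (intro borel_integrable_compact continuous_intros) auto
    then show ?thesis unfolding set_integrable_def by (simp add: borel_measurable_integrable)
  qed
  have lim1: "(\<lambda>n. LINT t|lborel. h t * exp (- (e n * t)) * fejer l (y - t)) \<longlonglongrightarrow> (LINT t|lborel. h t * fejer l (y - t))"
  proof (rule integral_dominated_convergence)
    show "integrable lborel (\<lambda>t. C * fejer l (y - t))" using integrable_fejer_shift[OF l] by simp
    show "AE t in lborel. (\<lambda>n. h t * exp (- (e n * t)) * fejer l (y - t)) \<longlonglongrightarrow> h t * fejer l (y - t)"
      by (intro AE_I2) (rule tendsto_eq_intros e0 refl | simp)+
    show "AE t in lborel. norm (h t * exp (- (e n * t)) * fejer l (y - t)) \<le> C * fejer l (y - t)" for n
    proof (rule AE_I2)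
      fix t
      have "\<bar>h t * exp (- (e n * t))\<bar> \<le> C"
      proof (cases "t < 0")
        case False
        then have "exp (- (e n * t)) \<le> 1" using e(1)[of n] by simp
        then have "\<bar>h t\<bar> * exp (- (e n * t)) \<le> C * 1" using h(2)[of t] by (intro mult_mono) auto
        then show ?thesis by (simp add: abs_mult)
      qed (use h(3) C0 in auto)
      then have "\<bar>h t * exp (- (e n * t))\<bar> * \<bar>fejer l (y - t)\<bar> \<le> C * fejer l (y - t)"
        using fejer_nonneg[OF l, of "y - t"] by (simp add: mult_right_mono)
      then show "norm (h t * exp (- (e n * t)) * fejer l (y - t)) \<le> C * fejer l (y - t)"
        by (simp add: abs_mult)
    qed
  qed simp_all
  have lim2: "(\<lambda>n. LINT u|lborel. ?g (e n) u) \<longlonglongrightarrow> (LINT u|lborel. ?g 0 u)"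
  proof (rule integral_dominated_convergence)
    show "integrable lborel (\<lambda>u. indicator {-l..l} u *\<^sub>R M)"
      using borel_integrable_compact[of "{-l..l}" "\<lambda>_. M"] by simp
    show "AE u in lborel. (\<lambda>n. ?g (e n) u) \<longlonglongrightarrow> ?g 0 u"
    proof (rule AE_I2)
      fix u
      have "(\<lambda>n. Complex (e n) u) \<longlonglongrightarrow> Complex 0 u" by (intro tendsto_Complex e0 tendsto_const)
      moreover have "Complex 0 u \<in> {z. Re z \<ge> 0}" "\<forall>n. Complex (e n) u \<in> {z. Re z \<ge> 0}"
        using e(1) by (auto simp: less_imp_le)
      ultimately have "(\<lambda>n. G (Complex (e n) u)) \<longlonglongrightarrow> G (Complex 0 u)"
        using cont unfolding continuous_on_sequentially by (auto simp: o_def)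
      then show "(\<lambda>n. ?g (e n) u) \<longlonglongrightarrow> ?g 0 u" by (intro tendsto_intros)
    qed
    show "AE u in lborel. norm (?g (e n) u) \<le> indicator {-l..l} u *\<^sub>R M" for n
    proof (rule AE_I2)
      fix u
      show "norm (?g (e n) u) \<le> indicator {-l..l} u *\<^sub>R M"
      proof (cases "u \<in> {-l..l}")
        case True
        have "\<bar>1 - \<bar>u\<bar> / l\<bar> \<le> 1" using True l by (auto simp: abs_le_iff field_simps)
        moreover have "cmod (G (Complex (e n) u)) \<le> M"
          using e[of n] True by (intro M inK) auto
        ultimately have "\<bar>1 - \<bar>u\<bar> / l\<bar> * 1 * cmod (G (Complex (e n) u)) \<le> 1 * 1 * M"
          by (intro mult_mono) auto
        then show ?thesis using True
          by (simp only: norm_mult norm_scaleR norm_of_real) (simp add: norm_exp_eq_Re)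
      qed simp
    qed
  qed (use meas e(1) in \<open>simp_all add: less_imp_le\<close>)
  have "complex_of_real (LINT t|lborel. h t * exp (- (e n * t)) * fejer l (y - t)) = (LINT u|lborel. ?g (e n) u)" for n
    using fejer_smoothing_damped[OF h e(1) l, where y = y] e(1)[of n] by (simp add: G)
  with tendsto_of_real[OF lim1, where 'a = complex] have "(\<lambda>n. LINT u|lborel. ?g (e n) u) \<longlonglongrightarrow> complex_of_real (LINT t|lborel. h t * fejer l (y - t))"
    by simp
  with lim2 have "complex_of_real (LINT t|lborel. h t * fejer l (y - t)) = (LINT u|lborel. ?g 0 u)"
    using LIMSEQ_unique by blast
  also have "\<dots> = integral {-l..l} (\<lambda>u. of_real (1 - \<bar>u\<bar> / l) * exp (\<i> * of_real u * of_real y) * G (Complex 0 u))"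
  proof -
    have "continuous_on {-l..l} (\<lambda>u. G (Complex 0 u))"
      by (rule continuous_on_compose2[OF cont]) (auto intro!: continuous_intros)
    then have "set_integrable lborel {-l..l} (\<lambda>u. of_real (1 - \<bar>u\<bar> / l) * exp (\<i> * of_real u * of_real y) * G (Complex 0 u))"
      unfolding set_integrable_def using l by (intro borel_integrable_compact continuous_intros) auto
    from set_borel_integral_eq_integral(2)[OF this] show ?thesis
      by (simp add: set_lebesgue_integral_def)
  qed
  also have "(\<lambda>u. Complex 0 u) = (\<lambda>u. \<i> * of_real u)" by (simp add: fun_eq_iff complex_eq_iff)
  finally show ?thesis by (simp add: mult_ac complex_eq_iff[of "Complex 0 _"] Complex_eq)
qed

text \<open>Holomorphy on a neighbourhood of the closed half-plane makes \<open>G\<close>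
  continuously differentiable along the imaginary axis. The triangle has a corner at 0, so the
  Riemann-Lebesgue lemma is applied to \<open>[-l, 0]\<close> and \<open>[0, l]\<close>
  separately.\<close>

lemma fejer_smoothing_tendsto_0:
  fixes h :: "real \<Rightarrow> real" and G :: "complex \<Rightarrow> complex"
  assumes h: "h \<in> borel_measurable borel" "\<And>t. \<bar>h t\<bar> \<le> C" "\<And>t. t < 0 \<Longrightarrow> h t = 0"
    and G: "\<And>z. Re z > 0 \<Longrightarrow> G z = (LINT t|lborel. of_real (h t) * exp (- z * of_real t))"
    and hol: "G holomorphic_on U" and U: "open U" "{z. Re z \<ge> 0} \<subseteq> U" and l: "l > 0"
  shows "((\<lambda>y. LINT t|lborel. h t * fejer l (y - t)) \<longlongrightarrow> 0) at_top"
proof -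
  have cont: "continuous_on {z. Re z \<ge> 0} G" "continuous_on {z. Re z \<ge> 0} (deriv G)"
    using holomorphic_on_imp_continuous_on[OF hol] holomorphic_on_imp_continuous_on[OF holomorphic_deriv[OF hol U(1)]] U(2)
    by (auto intro: continuous_on_subset)
  let ?E = "\<lambda>y u. exp (\<i> * of_real u * of_real y) :: complex"
  let ?F = "\<lambda>u. of_real (1 - \<bar>u\<bar> / l) * G (\<i> * of_real u)"
  have dG: "((\<lambda>u. G (\<i> * of_real u)) has_vector_derivative \<i> * deriv G (\<i> * of_real u)) (at u within S)" for u S
  proof -
    have "(G has_field_derivative deriv G (\<i> * of_real u)) (at (\<i> * of_real u))"
      using hol U by (intro holomorphic_derivI) auto
    then have "((\<lambda>z. G (\<i> * z)) has_field_derivative \<i> * deriv G (\<i> * of_real u)) (at (of_real u))"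
      using DERIV_chain[OF _ DERIV_cmult_Id, of G _ \<i> "of_real u"] by (simp add: o_def mult.commute[of _ \<i>])
    from has_vector_derivative_real_field[OF this] show ?thesis
      by (rule has_vector_derivative_at_within)
  qed
  have cG: "continuous_on S (\<lambda>u. G (\<i> * of_real u))" "continuous_on S (\<lambda>u. deriv G (\<i> * of_real u))" for S :: "real set"
    by (auto intro!: continuous_on_compose2[OF cont(1)] continuous_on_compose2[OF cont(2)] continuous_intros)
  have lim: "((\<lambda>y. integral {a..b} (\<lambda>u. ?F u * ?E y u)) \<longlongrightarrow> 0) at_top"
    if ab: "a \<le> b" and c: "\<And>u. u \<in> {a..b} \<Longrightarrow> \<bar>u\<bar> = c * u" for a b c :: real
  proof -
    let ?F1 = "\<lambda>u. of_real (1 - c * u / l) * G (\<i> * of_real u)"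
    have "((\<lambda>y. integral {a..b} (\<lambda>u. ?F1 u * ?E y u)) \<longlongrightarrow> 0) at_top"
    proof (rule riemann_lebesgue_C1[OF ab])
      fix u
      have "((\<lambda>u. complex_of_real (1 - c * u / l)) has_vector_derivative of_real (- (c / l))) (at u within {a..b})"
        using l by (intro has_vector_derivative_of_real)
          (auto intro!: derivative_eq_intros simp flip: has_real_derivative_iff_has_vector_derivative)
      from has_vector_derivative_mult[OF this dG]
      show "(?F1 has_vector_derivative of_real (1 - c * u / l) * (\<i> * deriv G (\<i> * of_real u)) + of_real (- (c / l)) * G (\<i> * of_real u)) (at u within {a..b})" .
    qed (use l in \<open>intro continuous_intros cG; simp\<close>)
    moreover have "integral {a..b} (\<lambda>u. ?F1 u * ?E y u) = integral {a..b} (\<lambda>u. ?F u * ?E y u)" for y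
      using c by (intro integral_cong) simp
    ultimately show ?thesis by simp
  qed
  have split: "integral {-l..l} (\<lambda>u. ?F u * ?E y u) = integral {-l..0} (\<lambda>u. ?F u * ?E y u) + integral {0..l} (\<lambda>u. ?F u * ?E y u)" for y
    using l by (intro Henstock_Kurzweil_Integration.integral_combine[symmetric] integrable_continuous_interval continuous_intros cG) auto
  have "((\<lambda>y. integral {-l..l} (\<lambda>u. ?F u * ?E y u)) \<longlongrightarrow> 0 + 0) at_top"
    unfolding split using l by (intro tendsto_add lim[of _ _ "-1"] lim[of _ _ 1]) auto
  then have "((\<lambda>y. complex_of_real (LINT t|lborel. h t * fejer l (y - t))) \<longlongrightarrow> of_real 0) at_top"
    by (simp add: fejer_smoothing[OF h G cont(1) l])
  then show ?thesis by (simp only: tendsto_of_real_iff)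
qed

text \<open>Within distance \<open>1 / l\<close> of \<open>c\<close> the kernel is at least
  \<open>l / 2\<close> on an interval of length \<open>2 / l\<close>, which yields
  \<open>\<eta>\<close>. Up to distance \<open>d\<close> the integrand is nonnegative. Beyond
  \<open>d\<close> it is at least minus \<open>B / (1 + (c - t)^2)\<close>, whose integral costs
  \<open>B * pi\<close>.\<close>

lemma fejer_smoothing_lower_bound:
  fixes g :: "real \<Rightarrow> real"
  assumes g: "g \<in> borel_measurable borel" "\<And>t. \<bar>g t\<bar> \<le> C"
    and d: "d > 0" and l: "l > 0" "1 / l \<le> d" and eta: "\<eta> \<ge> 0"
    and ge: "\<And>t. \<bar>c - t\<bar> \<le> d \<Longrightarrow> g t \<ge> \<eta>"
  shows "(LINT t|lborel. g t * fejer l (c - t)) \<ge> \<eta> - 4 * C * pi * (1 + 1 / d\<^sup>2) / l"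
proof -
  note [measurable] = g(1)
  have C0: "C \<ge> 0" using g(2)[of 0] by linarith
  define B where "B = 4 * C * (1 + 1 / d\<^sup>2) / l"
  have B0: "B \<ge> 0" using C0 l by (simp add: B_def)
  have ic: "integrable lborel (\<lambda>t. inverse (1 + (c - t)\<^sup>2))"
    using lborel_integrable_real_affine[OF integrable_cauchy, of "-1" c] by simp
  have ic': "(LINT t|lborel. inverse (1 + (c - t)\<^sup>2)) = pi"
    using lborel_integral_real_affine[of "-1" "\<lambda>v. inverse (1 + v\<^sup>2)" c] integral_cauchy by simp
  have ii: "integrable lborel (\<lambda>t. indicator {c - 1/l..c + 1/l} t :: real)"
    and ii': "(LINT t|lborel. indicator {c - 1/l..c + 1/l} t :: real) = 2 / l"
    using l by simp_all
  have "\<eta> - 4 * C * pi * (1 + 1 / d\<^sup>2) / l = \<eta> * l / 2 * (2 / l) - B * pi"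
    using l by (simp add: B_def)
  also have "\<dots> = (LINT t|lborel. \<eta> * l / 2 * indicator {c - 1/l..c + 1/l} t - B * inverse (1 + (c - t)\<^sup>2))"
    using ii ic l by (simp add: ii' ic')
  also have "\<dots> \<le> (LINT t|lborel. g t * fejer l (c - t))"
  proof (rule integral_mono)
    show "integrable lborel (\<lambda>t. \<eta> * l / 2 * indicator {c - 1/l..c + 1/l} t - B * inverse (1 + (c - t)\<^sup>2))"
      using ii ic by simp
    show "integrable lborel (\<lambda>t. g t * fejer l (c - t))"
      by (rule Bochner_Integration.integrable_bound[of _ "\<lambda>t. C * fejer l (c - t)"])
         (use integrable_fejer_shift[OF l(1)] g(2) C0 fejer_nonneg[OF l(1)] in
          \<open>auto simp: abs_mult intro!: AE_I2 mult_mono\<close>)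
    fix t
    have pos: "1 + (c - t)\<^sup>2 > 0" by (simp add: add_pos_nonneg)
    show "\<eta> * l / 2 * indicator {c - 1/l..c + 1/l} t - B * inverse (1 + (c - t)\<^sup>2) \<le> g t * fejer l (c - t)"
    proof (cases "\<bar>c - t\<bar> \<le> d")
      case True
      have "\<eta> * l / 2 * indicator {c - 1/l..c + 1/l} t \<le> \<eta> * fejer l (c - t)"
      proof (cases "t \<in> {c - 1/l..c + 1/l}")
        case near: True
        then have "\<bar>c - t\<bar> \<le> 1 / l" by (auto simp: abs_le_iff)
        from mult_left_mono[OF fejer_center_ge[OF l(1) this] eta] show ?thesis using near by simp
      qed (use eta fejer_nonneg[OF l(1)] in simp)
      also have "\<dots> \<le> g t * fejer l (c - t)"
        using ge[OF True] fejer_nonneg[OF l(1)] by (intro mult_right_mono)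
      finally show ?thesis using B0 pos by (smt (verit) mult_nonneg_nonneg inverse_nonnegative_iff_nonnegative)
    next
      case False
      define v where "v = c - t"
      have v: "\<bar>v\<bar> > d" "v \<noteq> 0" using False d by (auto simp: v_def)
      \<comment> \<open>This trades the tail \<open>1 / v^2\<close> for the Cauchy density at the
        price of the factor \<open>1 + 1 / d^2\<close>.\<close>
      have "d\<^sup>2 \<le> v\<^sup>2" using v d by (simp flip: abs_le_square_iff)
      then have "1 + v\<^sup>2 \<le> (1 + 1 / d\<^sup>2) * v\<^sup>2" using d by (simp add: field_simps)
      then have *: "1 / v\<^sup>2 \<le> (1 + 1 / d\<^sup>2) * inverse (1 + v\<^sup>2)"
        using v pos by (simp add: divide_simps v_def mult.commute)
      have "- (g t * fejer l v) \<le> C * fejer l v"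
        using g(2)[of t] fejer_nonneg[OF l(1), of v] by (metis abs_le_iff minus_mult_left mult_right_mono)
      also have "\<dots> \<le> C * (4 / (l * v\<^sup>2))"
        by (intro mult_left_mono fejer_tail_le l C0 v)
      also have "\<dots> = 4 * C / l * (1 / v\<^sup>2)" by simp
      also have "\<dots> \<le> 4 * C / l * ((1 + 1 / d\<^sup>2) * inverse (1 + v\<^sup>2))"
        using C0 l by (intro mult_left_mono *) auto
      also have "\<dots> = B * inverse (1 + v\<^sup>2)" by (simp add: B_def)
      finally have "- (B * inverse (1 + v\<^sup>2)) \<le> g t * fejer l v" by linarith
      moreover have "t \<notin> {c - 1/l..c + 1/l}" using False l by (auto simp: abs_le_iff)
      ultimately show ?thesis by (simp add: v_def)
    qed
  qed
  finally show ?thesis .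
qed

lemma tauberian_slowly_decreasing:
  fixes h :: "real \<Rightarrow> real" and G :: "complex \<Rightarrow> complex"
  assumes h: "h \<in> borel_measurable borel" "\<And>t. \<bar>h t\<bar> \<le> C" "\<And>t. t < 0 \<Longrightarrow> h t = 0"
    and mono: "\<And>s t. 0 \<le> s \<Longrightarrow> s \<le> t \<Longrightarrow> (1 + h s) * exp s \<le> (1 + h t) * exp t"
    and G: "\<And>z. Re z > 0 \<Longrightarrow> G z = (LINT t|lborel. of_real (h t) * exp (- z * of_real t))"
    and hol: "G holomorphic_on U" and U: "open U" "{z. Re z \<ge> 0} \<subseteq> U"
  shows "(h \<longlongrightarrow> 0) at_top"
proof (rule tendstoI)
  fix r :: real assume "r > 0"
  \<comment> \<open>The cap 1/2 keeps \<open>1 - 2 * \<eta>\<close> nonnegative, as the lower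
    estimate of \<open>h\<close> requires.\<close>
  define \<eta> where "\<eta> = min (r / 2) (1 / 2)"
  have eta: "\<eta> > 0" "\<eta> \<le> 1 / 2" "2 * \<eta> \<le> r" using \<open>r > 0\<close> by (auto simp: \<eta>_def)
  have C0: "C \<ge> 0" using h(2)[of 0] by linarith
  \<comment> \<open>Chosen so that \<open>(1 + 2 * \<eta>) / q = 1 + \<eta>\<close> and
    \<open>(1 - 2 * \<eta>) * q <= 1 - \<eta>\<close>. Since \<open>exp (2 * d) = q\<close>, a
    deviation of \<open>2 * \<eta>\<close> at a point leaves a deviation of \<open>\<eta>\<close>
    over an interval of length \<open>2 * d\<close>.\<close>
  define q where "q = (1 + 2 * \<eta>) / (1 + \<eta>)"
  have q: "q > 1" using eta by (simp add: q_def)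
  define d where "d = ln q / 2"
  have d: "d > 0" using q by (simp add: d_def)
  have exp_d: "exp (2 * d) = q" using q by (simp add: d_def)
  \<comment> \<open>The first entry puts the kernel's centre inside the window of radius
    \<open>d\<close>; the second makes the tail loss at most \<open>\<eta> / 2\<close>.\<close>
  define l where "l = max (1 / d) (8 * C * pi * (1 + 1 / d\<^sup>2) / \<eta>)"
  have l: "l > 0" "1 / l \<le> d" "4 * C * pi * (1 + 1 / d\<^sup>2) / l \<le> \<eta> / 2"
  proof -
    show l0: "l > 0" using d by (simp add: l_def less_max_iff_disj)
    have "1 / d \<le> l" by (simp add: l_def)
    then show "1 / l \<le> d" using d l0 by (simp add: field_simps)
    have "8 * C * pi * (1 + 1 / d\<^sup>2) / \<eta> \<le> l" by (simp add: l_def)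
    then have "8 * C * pi * (1 + 1 / d\<^sup>2) \<le> l * \<eta>" using eta(1) by (simp only: pos_divide_le_eq)
    then show "4 * C * pi * (1 + 1 / d\<^sup>2) / l \<le> \<eta> / 2" using l0 by (simp only: pos_divide_le_eq) (simp add: mult_ac)
  qed
  let ?I = "\<lambda>y. LINT t|lborel. h t * fejer l (y - t)"
  have "(?I \<longlongrightarrow> 0) at_top" by (rule fejer_smoothing_tendsto_0[OF h G hol U l(1)])
  from tendstoD[OF this, of "\<eta> / 2"] have "eventually (\<lambda>y. \<bar>?I y\<bar> < \<eta> / 2) at_top"
    using eta by (simp add: dist_norm)
  then obtain Y where Y: "\<And>y. y \<ge> Y \<Longrightarrow> \<bar>?I y\<bar> < \<eta> / 2" by (auto simp: eventually_at_top_linorder)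
  show "eventually (\<lambda>y. dist (h y) 0 < r) at_top"
    \<comment> \<open>Both centres \<open>y + d\<close> and \<open>y - d\<close> are then at least
      \<open>Y\<close>, and \<open>y - 2 * d\<close> is nonnegative, where \<open>mono\<close>
      applies.\<close>
    using eventually_ge_at_top[of "max (Y + d) (2 * d)"]
  proof eventually_elim
    case (elim y)
    have "h y < 2 * \<eta>"
    proof (rule ccontr)
      assume asm: "\<not> h y < 2 * \<eta>"
      \<comment> \<open>A large positive value persists to the right, on
        \<open>[y, y + 2 * d]\<close>; a large negative value persists to the left, on
        \<open>[y - 2 * d, y]\<close>.\<close>
      have "?I (y + d) \<ge> \<eta> - 4 * C * pi * (1 + 1 / d\<^sup>2) / l"
      proof (rule fejer_smoothing_lower_bound[OF h(1,2) d l(1,2)])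
        fix t assume t: "\<bar>y + d - t\<bar> \<le> d"
        have "(1 + 2 * \<eta>) * exp y \<le> (1 + h y) * exp y" using asm by simp
        also have "\<dots> \<le> (1 + h t) * exp t" using t elim d by (intro mono) (auto simp: abs_le_iff)
        finally have "(1 + 2 * \<eta>) * exp (y - t) \<le> 1 + h t" by (simp add: exp_diff field_simps)
        moreover have "exp (- (2 * d)) \<le> exp (y - t)" using t by (simp add: abs_le_iff)
        then have "1 / q \<le> exp (y - t)" by (simp add: exp_minus exp_d inverse_eq_divide)
        then have "(1 + 2 * \<eta>) * (1 / q) \<le> (1 + 2 * \<eta>) * exp (y - t)" using eta by (intro mult_left_mono) auto
        moreover have "(1 + 2 * \<eta>) * (1 / q) = 1 + \<eta>" using eta by (simp add: q_def)
        ultimately show "\<eta> \<le> h t" by linarith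
      qed (use eta in auto)
      then show False using Y[of "y + d"] l(3) elim d by linarith
    qed
    moreover have "h y > - 2 * \<eta>"
    proof (rule ccontr)
      assume asm: "\<not> h y > - 2 * \<eta>"
      have "(LINT t|lborel. - h t * fejer l (y - d - t)) \<ge> \<eta> - 4 * C * pi * (1 + 1 / d\<^sup>2) / l"
      proof (rule fejer_smoothing_lower_bound[OF _ _ d l(1,2)])
        fix t assume t: "\<bar>y - d - t\<bar> \<le> d"
        have "(1 + h t) * exp t \<le> (1 + h y) * exp y" using t elim d by (intro mono) (auto simp: abs_le_iff)
        also have "\<dots> \<le> (1 - 2 * \<eta>) * exp y" using asm by simp
        finally have "1 + h t \<le> (1 - 2 * \<eta>) * exp (y - t)" by (simp add: exp_diff field_simps)
        also have "exp (y - t) \<le> exp (2 * d)" using t by (simp add: abs_le_iff)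
        then have "(1 - 2 * \<eta>) * exp (y - t) \<le> (1 - 2 * \<eta>) * q" using eta by (intro mult_left_mono) (auto simp: exp_d)
        also have "\<dots> \<le> 1 - \<eta>" using eta by (simp add: q_def field_simps)
        finally show "\<eta> \<le> - h t" by linarith
      qed (use eta h(1,2) in auto)
      then show False using Y[of "y - d"] l(3) elim d by simp
    qed
    ultimately show ?case using eta by (simp add: dist_norm abs_less_iff)
  qed
qed

text \<open>The integral is the limit of the integrals over \<open>[a, a + n]\<close>. The third
  part supplies the L1 norms that justify exchanging sum and integral in
  \<open>laplace_psi\<close>.\<close>

lemma laplace_exp_tail:
  assumes w: "Re w > 0" and a: "a \<ge> 0"
  shows "integrable lborel (\<lambda>t. indicator {a..} t *\<^sub>R exp (- w * of_real t))" (is ?i)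
    and "(LINT t|lborel. indicator {a..} t *\<^sub>R exp (- w * of_real t)) = exp (- w * of_real a) / w"
    and "(LINT t|lborel. norm (indicator {a..} t *\<^sub>R exp (- w * of_real t))) = exp (- Re w * a) / Re w"
proof -
  have nrm: "norm (indicator {a..} t *\<^sub>R exp (- w * of_real t)) = indicator {a..} t *\<^sub>R exp (- Re w * t)" for t
    by (simp add: norm_exp_eq_Re indicator_def)
  have "integrable lborel (\<lambda>t. indicator {a..} t * exp (- (Re w * t)))"
    by (rule integrable_exp_decay[OF _ _ _ w, where C = 1]) (use a in \<open>auto simp: indicator_def\<close>)
  then show i: ?i
    by (rule Bochner_Integration.integrable_bound) (auto simp: norm_exp_eq_Re indicator_def)
  \<comment> \<open>Stated for general \<open>v\<close>, because it is applied to \<open>w\<close>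
    for the integral and to \<open>Re w\<close> for the norm.\<close>
  have main: "(LINT t|lborel. indicator {a..} t *\<^sub>R exp (- v * of_real t)) = exp (- v * of_real a) / v"
    if v: "Re v > 0" and iv: "integrable lborel (\<lambda>t. indicator {a..} t *\<^sub>R exp (- v * of_real t))" for v
  proof -
    have v0: "v \<noteq> 0" using v by auto
    have "(\<lambda>n. LINT t|lborel. indicator {a..a + real n} t *\<^sub>R exp (- v * of_real t))
        \<longlonglongrightarrow> (LINT t|lborel. indicator {a..} t *\<^sub>R exp (- v * of_real t))"
    proof (rule integral_dominated_convergence)
      show "integrable lborel (\<lambda>t. norm (indicator {a..} t *\<^sub>R exp (- v * of_real t)))"
        using iv by (rule integrable_norm)
      show "AE t in lborel. (\<lambda>n. indicator {a..a + real n} t *\<^sub>R exp (- v * of_real t)) \<longlonglongrightarrow> indicator {a..} t *\<^sub>R exp (- v * of_real t)"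
      proof (rule AE_I2)
        fix t
        obtain N where N: "t - a \<le> real N" using real_arch_simple by blast
        have "eventually (\<lambda>n. indicator {a..a + real n} t *\<^sub>R exp (- v * of_real t) = indicator {a..} t *\<^sub>R exp (- v * of_real t)) sequentially"
          using eventually_ge_at_top[of N] by eventually_elim (use N in \<open>auto simp: indicator_def\<close>)
        then show "(\<lambda>n. indicator {a..a + real n} t *\<^sub>R exp (- v * of_real t)) \<longlonglongrightarrow> indicator {a..} t *\<^sub>R exp (- v * of_real t)"
          by (rule tendsto_eventually)
      qed
    qed (auto simp: indicator_def)
    moreover have "(LINT t|lborel. indicator {a..a + real n} t *\<^sub>R exp (- v * of_real t))
        = - exp (- v * of_real (a + real n)) / v - - exp (- v * of_real a) / v" for n
    proof (rule integral_FTC_atLeastAtMost)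
      fix t
      have "((\<lambda>z. - exp (- v * z) / v) has_field_derivative exp (- v * of_real t)) (at (of_real t))"
        using v0 by (auto intro!: derivative_eq_intros)
      from has_vector_derivative_real_field[OF this]
      show "((\<lambda>t. - exp (- v * of_real t) / v) has_vector_derivative exp (- v * of_real t)) (at t within {a..a + real n})"
        by (rule has_vector_derivative_at_within)
    qed (auto intro!: continuous_intros)
    moreover have "(\<lambda>n. - exp (- v * of_real (a + real n)) / v - - exp (- v * of_real a) / v) \<longlonglongrightarrow> - 0 / v - - exp (- v * of_real a) / v"
    proof (intro tendsto_intros)
      show "(\<lambda>n. exp (- v * of_real (a + real n))) \<longlonglongrightarrow> 0"
      proof (rule tendsto_norm_zero_cancel)
        have "(\<lambda>n. exp (- Re v * (a + real n))) \<longlonglongrightarrow> 0" using v by real_asymp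
        then show "(\<lambda>n. norm (exp (- v * of_real (a + real n)))) \<longlonglongrightarrow> 0" by (simp add: norm_exp_eq_Re)
      qed
    qed (use v0 in auto)
    ultimately show ?thesis using LIMSEQ_unique by fastforce
  qed
  show "(LINT t|lborel. indicator {a..} t *\<^sub>R exp (- w * of_real t)) = exp (- w * of_real a) / w"
    by (rule main[OF w i])
  have eq: "indicator {a..} t *\<^sub>R exp (- of_real (Re w) * of_real t) = complex_of_real (norm (indicator {a..} t *\<^sub>R exp (- w * of_real t)))" for t
    unfolding nrm by (simp add: scaleR_conv_of_real exp_of_real[symmetric])
  have "(LINT t|lborel. complex_of_real (norm (indicator {a..} t *\<^sub>R exp (- w * of_real t)))) = exp (- of_real (Re w) * of_real a) / of_real (Re w)"
    unfolding eq[symmetric]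
  proof (rule main)
    show "integrable lborel (\<lambda>t. indicator {a..} t *\<^sub>R exp (- complex_of_real (Re w) * of_real t))"
      unfolding eq using integrable_norm[OF i] by (simp only: complex_of_real_integrable_eq)
  qed (use w in simp)
  then have "complex_of_real (LINT t|lborel. norm (indicator {a..} t *\<^sub>R exp (- w * of_real t))) = complex_of_real (exp (- Re w * a) / Re w)"
    by (simp only: integral_complex_of_real) (simp add: exp_of_real[symmetric])
  then show "(LINT t|lborel. norm (indicator {a..} t *\<^sub>R exp (- w * of_real t))) = exp (- Re w * a) / Re w"
    by (simp only: of_real_eq_iff)
qed

section \<open>The prime number theorem\<close>

text \<open>The relative error of the psi function in the variable \<open>t = ln x\<close>, cut off
  at negative \<open>t\<close> to meet the support condition of the Tauberian theorem.\<close>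

definition psi_error :: "real \<Rightarrow> real" where
  "psi_error t = (if t \<ge> 0 then chebyshev_psi (exp t) * exp (- t) - 1 else 0)"

text \<open>\<open>chebyshev_psi (exp t)\<close> is the sum of \<open>mangoldt n\<close> over the
  steps at \<open>t = ln n\<close>, and each step integrates to \<open>n powr - w / w\<close>. The
  norms of the integrals are summable, so integration is termwise.\<close>

lemma laplace_psi:
  assumes w: "Re w > 1"
  shows "integrable lborel (\<lambda>t. of_real (chebyshev_psi (exp t)) * exp (- w * of_real t))"
    and "(LINT t|lborel. of_real (chebyshev_psi (exp t)) * exp (- w * of_real t)) = mangoldt_series w / w"
proof -
  define f where "f = (\<lambda>n t. mangoldt n * (indicator {ln (real n)..} t *\<^sub>R exp (- w * of_real t)) :: complex)"
  have w0: "Re w > 0" using w by simp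
  have f0: "f 0 t = 0" for t by (simp add: f_def)
  have ln0: "ln (real n) \<ge> 0" for n by (cases "n = 0") auto
  have ipowr: "exp (- w * of_real (ln (real n))) = of_nat n powr - w" if "n > 0" for n
    using that by (simp add: powr_def)
  have int: "integrable lborel (f n)" for n
    unfolding f_def using laplace_exp_tail(1)[OF w0 ln0] by (rule integrable_mult_right)
  have If: "(LINT t|lborel. f n t) = mangoldt n * of_nat n powr - w / w" for n
    unfolding f_def integral_mult_right_zero laplace_exp_tail(2)[OF w0 ln0]
    using ipowr[of n] by (cases "n = 0") simp_all
  have Inf: "(LINT t|lborel. norm (f n t)) = norm (mangoldt n * of_nat n powr - w :: complex) / Re w" for n
  proof (cases "n = 0")
    case False
    then have "exp (- Re w * ln (real n)) = real n powr - Re w" by (simp add: powr_def)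
    then show ?thesis
      unfolding f_def norm_mult using laplace_exp_tail(3)[OF w0 ln0[of n]]
      by (simp add: norm_nat_powr)
  qed (simp add: f0)
  have fsum: "f n t = (if n \<in> {n. 0 < n \<and> real n \<le> exp t} then mangoldt n * exp (- w * of_real t) else 0)" for n t
  proof (cases "n = 0")
    case False
    then have "ln (real n) \<le> t \<longleftrightarrow> real n \<le> exp t" by (metis exp_le_cancel_iff exp_ln of_nat_0_less_iff neq0_conv)
    then show ?thesis using False by (auto simp: f_def indicator_def)
  qed (simp add: f0)
  have sums: "(\<lambda>n. f n t) sums (of_real (chebyshev_psi (exp t)) * exp (- w * of_real t))" for t
  proof -
    have "(\<lambda>n. f n t) sums (\<Sum>n | 0 < n \<and> real n \<le> exp t. mangoldt n * exp (- w * of_real t))"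
      unfolding fsum by (rule sums_If_finite_set) simp
    then show ?thesis by (simp add: chebyshev_psi_def sum_distrib_right)
  qed
  have psi_eq: "of_real (chebyshev_psi (exp t)) * exp (- w * of_real t) = (\<Sum>n. f n t)" for t
    using sums[of t] by (simp add: sums_iff)
  have "summable (\<lambda>n. norm (f n t))" for t
    by (rule summable_finite[of "{n. 0 < n \<and> real n \<le> exp t}"]) (auto simp: fsum)
  then have AE: "AE t in lborel. summable (\<lambda>n. norm (f n t))" by simp
  have S: "summable (\<lambda>n. LINT t|lborel. norm (f n t))"
    unfolding Inf using summable_norm_mangoldt_series[OF w] by (rule summable_divide)
  show "integrable lborel (\<lambda>t. of_real (chebyshev_psi (exp t)) * exp (- w * of_real t))"
    unfolding psi_eq by (rule integrable_suminf[OF int AE S])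
  have "(LINT t|lborel. (\<Sum>n. f n t)) = (\<Sum>n. LINT t|lborel. f n t)"
    by (rule integral_suminf[OF int AE S])
  also have "\<dots> = mangoldt_series w / w"
    unfolding If mangoldt_series_def
    by (rule suminf_divide) (rule summable_norm_cancel[OF summable_norm_mangoldt_series[OF w]])
  finally show "(LINT t|lborel. of_real (chebyshev_psi (exp t)) * exp (- w * of_real t)) = mangoldt_series w / w"
    unfolding psi_eq .
qed

text \<open>The factor \<open>exp (- t)\<close> shifts the argument to \<open>1 + z\<close>, and the
  subtracted 1 contributes \<open>- 1 / z\<close>. This cancels the pole of the Mangoldt series,
  since \<open>1 / (z * (1 + z)) - 1 / z = - 1 / (1 + z)\<close>.\<close>

lemma laplace_psi_error:
  assumes z: "Re z > 0"
  shows "(LINT t|lborel. of_real (psi_error t) * exp (- z * of_real t)) =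
     - (1 + deriv zeta_reg (1 + z) / zeta_reg (1 + z)) / (1 + z)"
proof -
  have w: "Re (1 + z) > 1" using z by simp
  have eq: "of_real (psi_error t) * exp (- z * of_real t) = of_real (chebyshev_psi (exp t)) * exp (- (1 + z) * of_real t)
     - indicator {0..} t *\<^sub>R exp (- z * of_real t)" for t
  proof (cases "t \<ge> 0")
    case True
    have "exp (- (1 + z) * of_real t) = of_real (exp (- t)) * exp (- z * of_real t)"
      by (simp only: exp_of_real[symmetric] exp_add[symmetric]) (simp add: algebra_simps)
    then show ?thesis using True by (simp add: psi_error_def left_diff_distrib)
  next
    case False
    then have "\<lfloor>exp t\<rfloor> \<le> 0" by (simp add: floor_le_zero)
    then have "chebyshev_psi (exp t) = 0" by (simp add: chebyshev_psi_eq_sum)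
    then show ?thesis using False by (simp add: psi_error_def)
  qed
  have "(LINT t|lborel. of_real (psi_error t) * exp (- z * of_real t)) = mangoldt_series (1 + z) / (1 + z) - 1 / z"
    unfolding eq using laplace_psi[OF w] laplace_exp_tail(1,2)[OF z, of 0]
    by (subst Bochner_Integration.integral_diff) auto
  moreover have "deriv zeta_reg (1 + z) / zeta_reg (1 + z) = 1 / z - mangoldt_series (1 + z)"
    using deriv_zeta_reg[OF w] zeta_reg_nonzero[of "1 + z"] z by simp
  then have "mangoldt_series (1 + z) = 1 / z - deriv zeta_reg (1 + z) / zeta_reg (1 + z)" by simp
  moreover have "z \<noteq> 0" "1 + z \<noteq> 0" using z by (auto simp: complex_eq_iff)
  ultimately show ?thesis by (simp only:) (simp add: divide_simps, simp add: algebra_simps)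
qed

lemma psi_error_tendsto_0: "(psi_error \<longlongrightarrow> 0) at_top"
proof (rule tauberian_slowly_decreasing)
  have "mono chebyshev_psi" by (auto intro!: monoI chebyshev_psi_mono)
  from borel_measurable_mono[OF this] have [measurable]: "chebyshev_psi \<in> borel_measurable borel" .
  show "psi_error \<in> borel_measurable borel" unfolding psi_error_def by measurable
  show "\<bar>psi_error t\<bar> \<le> 4" for t
  proof (cases "t \<ge> 0")
    case True
    have "chebyshev_psi (exp t) * exp (- t) \<le> 4 * exp t * exp (- t)"
      by (intro mult_right_mono chebyshev_psi_le) auto
    also have "\<dots> = 4" by (simp add: exp_minus)
    finally have "chebyshev_psi (exp t) * exp (- t) \<le> 4" .
    moreover have "0 \<le> chebyshev_psi (exp t) * exp (- t)" using chebyshev_psi_nonneg by simp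
    ultimately show ?thesis using True by (simp add: psi_error_def abs_le_iff)
  qed (simp add: psi_error_def)
  show "(1 + psi_error s) * exp s \<le> (1 + psi_error t) * exp t" if "0 \<le> s" "s \<le> t" for s t
    using that chebyshev_psi_mono[of "exp s" "exp t"] by (simp add: psi_error_def exp_minus mult.assoc)
  \<comment> \<open>An open set on which the transform is holomorphic; it contains the closed
    half-plane exactly because \<open>zeta_reg\<close> has no zeros on
    \<open>Re s >= 1\<close>.\<close>
  let ?U = "(\<lambda>z. 1 + z) -` {s \<in> {s. Re s > 0}. zeta_reg s \<noteq> 0}"
  have op: "open {s \<in> {s. Re s > 0}. zeta_reg s \<noteq> 0}"
    using continuous_open_preimage[OF holomorphic_on_imp_continuous_on[OF holomorphic_zeta_reg] open_halfspace_Re_gt, of "- {0}"]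
    by (simp add: vimage_def Int_def open_Compl)
  then show "open ?U" by (intro open_vimage continuous_intros)
  show "{z. Re z \<ge> 0} \<subseteq> ?U" using zeta_reg_nonzero by auto
  have hol: "zeta_reg holomorphic_on {s \<in> {s. Re s > 0}. zeta_reg s \<noteq> 0}"
    by (rule holomorphic_on_subset[OF holomorphic_zeta_reg]) auto
  have "(\<lambda>s. - (1 + deriv zeta_reg s / zeta_reg s) / s) holomorphic_on {s \<in> {s. Re s > 0}. zeta_reg s \<noteq> 0}"
    by (intro holomorphic_intros hol holomorphic_deriv[OF hol op]) auto
  from holomorphic_on_compose_gen[OF _ this, of "\<lambda>z. 1 + z" ?U]
  show "(\<lambda>z. - (1 + deriv zeta_reg (1 + z) / zeta_reg (1 + z)) / (1 + z)) holomorphic_on ?U"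
    by (simp add: o_def holomorphic_intros image_subset_iff)
  show "- (1 + deriv zeta_reg (1 + z) / zeta_reg (1 + z)) / (1 + z)
      = (LINT t|lborel. of_real (psi_error t) * exp (- z * of_real t))" if "Re z > 0" for z
    using laplace_psi_error[OF that] by (rule sym)
qed (simp add: psi_error_def)

lemma chebyshev_psi_asymptotic: "((\<lambda>x. chebyshev_psi x / x) \<longlongrightarrow> 1) at_top"
proof -
  have "((\<lambda>x. 1 + psi_error (ln x)) \<longlongrightarrow> 1 + 0) at_top"
    by (intro tendsto_intros filterlim_compose[OF psi_error_tendsto_0 ln_at_top])
  moreover have "eventually (\<lambda>x. 1 + psi_error (ln x) = chebyshev_psi x / x) at_top"
    using eventually_ge_at_top[of 1]
    by eventually_elim (simp add: psi_error_def exp_minus divide_inverse)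
  ultimately show ?thesis by (simp add: tendsto_cong)
qed

theorem prime_number_theorem: "((\<lambda>x. real (prime_pi x) * ln x / x) \<longlongrightarrow> 1) at_top"
proof (rule tendsto_sandwich)
  show "eventually (\<lambda>x. chebyshev_psi x / x \<le> real (prime_pi x) * ln x / x) at_top"
    using eventually_ge_at_top[of 1]
    by eventually_elim (auto intro!: divide_right_mono chebyshev_psi_le_prime_pi)
  let ?r = "\<lambda>x::real. ln x / (ln x - 2 * ln (ln x))"
  have "eventually (\<lambda>x::real. 1 < x / (ln x)\<^sup>2) at_top" by real_asymp
  moreover have "eventually (\<lambda>x::real. ln x > 1) at_top" by real_asymp
  ultimately show "eventually (\<lambda>x. real (prime_pi x) * ln x / x \<le> 1 / ln x + chebyshev_psi x / x * ?r x) at_top"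
    using eventually_gt_at_top[of 1]
  proof eventually_elim
    case (elim x)
    \<comment> \<open>This cut makes the trivial part \<open>y * ln x / x\<close> equal to
      \<open>1 / ln x\<close>, while \<open>ln y\<close> is still asymptotic to
      \<open>ln x\<close>.\<close>
    define y where "y = x / (ln x)\<^sup>2"
    have "y \<le> x" using elim by (auto simp: y_def field_simps)
    have lny: "ln y = ln x - 2 * ln (ln x)"
      using elim by (simp add: y_def ln_div ln_realpow)
    have "real (prime_pi x) * ln x / x \<le> (y + chebyshev_psi x / ln y) * ln x / x"
      using elim \<open>y \<le> x\<close>
      by (intro divide_right_mono mult_right_mono prime_pi_le_chebyshev_psi) (auto simp: y_def)
    also have "\<dots> = 1 / ln x + chebyshev_psi x / x * (ln x / ln y)"
      using elim by (simp add: y_def add_divide_distrib distrib_right power2_eq_square)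
    finally show ?case by (simp add: lny)
  qed
  have 1: "((\<lambda>x::real. 1 / ln x) \<longlongrightarrow> 0) at_top" by real_asymp
  have 2: "(?r \<longlongrightarrow> 1) at_top" by real_asymp
  from tendsto_add[OF 1 tendsto_mult[OF chebyshev_psi_asymptotic 2]]
  show "((\<lambda>x. 1 / ln x + chebyshev_psi x / x * ?r x) \<longlongrightarrow> 1) at_top" by simp
qed (fact chebyshev_psi_asymptotic)

text \<open>Apply the prime number theorem at \<open>x / 2\<close> and at \<open>x\<close>; the
  factor 1/2 is the limit of \<open>ln x / (2 * ln (x / 2))\<close>, and the added 1 becomes the
  vanishing term \<open>ln x / x\<close>.\<close>

lemma prime_pi_half_ratio: "((\<lambda>x. (real (prime_pi (x / 2)) + 1) / real (prime_pi x)) \<longlongrightarrow> 1/2) at_top"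
proof -
  let ?f = "\<lambda>x. real (prime_pi x) * ln x / x"
  have "filterlim (\<lambda>x::real. x / 2) at_top at_top" by real_asymp
  from filterlim_compose[OF prime_number_theorem this] have 1: "((\<lambda>x. ?f (x/2)) \<longlongrightarrow> 1) at_top" .
  have 2: "((\<lambda>x::real. ln x / (2 * ln (x / 2))) \<longlongrightarrow> 1/2) at_top"
          "((\<lambda>x::real. ln x / x) \<longlongrightarrow> 0) at_top" by real_asymp+
  have "((\<lambda>x. (?f (x/2) * (ln x / (2 * ln (x / 2))) + ln x / x) / ?f x) \<longlongrightarrow> (1 * (1/2) + 0) / 1) at_top"
    by (intro tendsto_intros 1 2 prime_number_theorem) auto
  moreover have "eventually (\<lambda>x. (?f (x/2) * (ln x / (2 * ln (x / 2))) + ln x / x) / ?f x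
      = (real (prime_pi (x / 2)) + 1) / real (prime_pi x)) at_top"
    using eventually_gt_at_top[of 3]
  proof eventually_elim
    case (elim x)
    have "ln (x/2) > 0" "ln x > 0" using elim by simp_all
    then have "?f (x/2) * (ln x / (2 * ln (x / 2))) + ln x / x = (real (prime_pi (x / 2)) + 1) * (ln x / x)"
      using elim by (simp add: field_simps)
    then show ?case using elim \<open>ln x > 0\<close> by simp
  qed
  ultimately show ?thesis by (simp add: tendsto_cong)
qed

theorem theorem2:
  shows "Liminf at_top (\<lambda>x::real. ereal (real (rpr_pi x) / real (prime_pi x))) \<ge> ereal (1/2)"
proof -
  let ?r = "\<lambda>x. (real (prime_pi (x / 2)) + 1) / real (prime_pi x)"
  have "((\<lambda>x. 1 - ?r x) \<longlongrightarrow> 1 - 1/2) at_top"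
    by (intro tendsto_diff tendsto_const prime_pi_half_ratio)
  then have "((\<lambda>x. ereal (1 - ?r x)) \<longlongrightarrow> ereal (1/2)) at_top" by simp
  then have "Liminf at_top (\<lambda>x. ereal (1 - ?r x)) = ereal (1/2)"
    by (intro lim_imp_Liminf) auto
  moreover have "Liminf at_top (\<lambda>x. ereal (1 - ?r x))
      \<le> Liminf at_top (\<lambda>x. ereal (real (rpr_pi x) / real (prime_pi x)))"
  proof (rule Liminf_mono)
    show "eventually (\<lambda>x. ereal (1 - ?r x) \<le> ereal (real (rpr_pi x) / real (prime_pi x))) at_top"
      \<comment> \<open>From 2 on \<open>prime_pi x\<close> is positive, so the counting inequality
        may be divided by it.\<close>
      using eventually_ge_at_top[of 2]
    proof eventually_elim
      case (elim x)
      then have "2 \<in> {p::nat. prime p \<and> real p \<le> x}" by simp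
      then have "prime_pi x > 0" unfolding prime_pi_def by (subst card_gt_0_iff) (auto simp del: mem_Collect_eq)
      moreover have "real (prime_pi x) \<le> real (rpr_pi x) + (real (prime_pi (x / 2)) + 1)"
        using prime_pi_le_rpr_pi[of x] by linarith
      ultimately have "real (prime_pi x) - (real (prime_pi (x / 2)) + 1) \<le> real (rpr_pi x)"
        and "real (prime_pi x) > 0" by simp_all
      then have "(real (prime_pi x) - (real (prime_pi (x / 2)) + 1)) / real (prime_pi x)
          \<le> real (rpr_pi x) / real (prime_pi x)" by (intro divide_right_mono) auto
      then show ?case using \<open>real (prime_pi x) > 0\<close> by (simp add: diff_divide_distrib)
    qed
  qed
  ultimately show ?thesis by simp
qed

end
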